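(* Let $n \ge 2$ and let $G$ be a (not necessarily connected) finite simple graph on the vertex set $[n-1]=\{1,\dots,n-1\}$. Let $\widehat{G}$ be the suspension of $G$, let $\mathcal{P}_{\widehat{G}}$ be its symmetric edge polytope, and let $N(\mathcal{P}_{\widehat{G}})$ be the number of facets of $\mathcal{P}_{\widehat{G}}$. Then $$N(\mathcal{P}_{\widehat{G}}) \ge 2^{n-1},$$ and equality holds if and only if $G$ is an empty graph (i.e., a graph having no edges), and hence $\widehat{G}$ is a star graph $K_{1,n-1}$. Moreover, $$N(\mathcal{P}_{\widehat{G}}) \le \begin{cases} 6^{\frac{n-1}{2}} & \text{if } n \text{ is odd},\\ 14\cdot 6^{\frac{n}{2}-2} & \text{if } n \text{ is even},\end{cases}$$ and equality holds if and only if one of the following holds: (a) $n$ is odd, and $G$ is a disjoint union of $(n-1)/2$ edges, and hence $\widehat{G}$ is a $1$-sum of $(n-1)/2$ triangles; (b) $n$ is even, and $G$ is a disjoint union of $n/2-2$ edges with a triangle, and hence $\widehat{G}$ is a $1$-sum of $K_4$ with $n/2-2$ triangles.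
   Context: For a finite simple graph $G$ with vertex set $V$ and edge set $E(G)$, the symmetric edge polytope $\mathcal{P}_G$ is the convex hull in $\mathbb{R}^V$ of $\{\pm(\mathbf{e}_i-\mathbf{e}_j) : \{i,j\}\in E(G)\}$, where $\mathbf{e}_i$ is the $i$-th unit coordinate vector. (If $G$ is connected with $n$ vertices, $\mathcal{P}_G$ has dimension $n-1$.) $N(\mathcal{P})$ denotes the number of facets (faces of dimension $\dim\mathcal{P}-1$) of a polytope $\mathcal{P}$. For a graph $G=([n-1],E)$, the suspension $\widehat{G}$ is the graph on the vertex set $[n]$ with edge set $E\cup\{\{i,n\} : i\in[n-1]\}$. If $G_1$ and $G_2$ are graphs with exactly one common vertex, the $1$-sum of $G_1$ and $G_2$ is their union; the $1$-sum of several graphs is defined by a sequence of $1$-sums. $K_m$ is the complete graph on $m$ vertices and $K_{\ell,m}$ the complete bipartite graph with parts of sizes $\ell$ and $m$. Here "a disjoint union of $k$ edges" means a graph whose connected components are exactly $k$ copies of $K_2$, and "a disjoint union of $k$ edges with a triangle" means a graph whose connected components are exactly $k$ copies of $K_2$ and one copy of $K_3$ (no isolated vertices). *)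

theory Defs
  imports "HOL-Analysis.Analysis" "Graph_Theory.Graph_Theory"
begin

text \<open>
  A finite simple graph is a \<^locale>\<open>pair_graph\<close>: finite, loop-free and symmetric, with the edge
  \<open>{u, v}\<close> represented by the two arcs \<open>(u, v)\<close> and \<open>(v, u)\<close>.
  Since the graphs are symmetric, the strongly connected components \<^const>\<open>pre_digraph.sccs\<close> are
  the connected components, as induced subgraphs; an isolated vertex is a component.
\<close>

text \<open>
  The ambient space \<open>real ^ 'v\<close> is \<open>\<real>\<^sup>V\<close> with \<open>V = UNIV :: 'v set\<close>, so the vertex set of the graph
  is meant to be all of \<open>'v\<close>.
\<close>

definition symmetric_edge_polytope :: "'v::finite pair_pre_digraph \<Rightarrow> (real ^ 'v) set" where
  "symmetric_edge_polytope G =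
     convex hull (\<Union>(i, j) \<in> parcs G. {axis i 1 - axis j 1, - (axis i 1 - axis j 1)})"

definition num_facets :: "'a::euclidean_space set \<Rightarrow> nat" where
  "num_facets P = card {F. F facet_of P}"

text \<open>The apex of the suspension is \<^const>\<open>None\<close>.\<close>

definition suspension :: "'v pair_pre_digraph \<Rightarrow> 'v option pair_pre_digraph" where
  "suspension G =
     \<lparr> pverts = insert None (Some ` pverts G),
       parcs = {(Some u, Some v) | u v. (u, v) \<in> parcs G}
             \<union> {(Some u, None) | u. u \<in> pverts G}
             \<union> {(None, Some u) | u. u \<in> pverts G} \<rparr>"

definition disjoint_union_of_edges :: "nat \<Rightarrow> 'v pair_pre_digraph \<Rightarrow> bool" where
  "disjoint_union_of_edges k G \<longleftrightarrow>
     card (pre_digraph.sccs (with_proj G)) = k \<and>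
     (\<forall>C \<in> pre_digraph.sccs (with_proj G). complete_digraph 2 C)"

definition disjoint_union_of_edges_with_triangle :: "nat \<Rightarrow> 'v pair_pre_digraph \<Rightarrow> bool" where
  "disjoint_union_of_edges_with_triangle k G \<longleftrightarrow>
     (\<exists>T \<in> pre_digraph.sccs (with_proj G).
        complete_digraph 3 T \<and>
        card (pre_digraph.sccs (with_proj G) - {T}) = k \<and>
        (\<forall>C \<in> pre_digraph.sccs (with_proj G) - {T}. complete_digraph 2 C))"

text \<open>
  \<open>is_one_sum Gs H\<close>: \<open>H\<close> arises from the graphs \<open>Gs\<close> by successive \<open>1\<close>-sums. The condition
  \<^const>\<open>compatible\<close> (equal tail and head functions) makes \<^const>\<open>union\<close> meaningful; it always
  holds between graphs of the form \<^term>\<open>with_proj G\<close>.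
\<close>

inductive is_one_sum :: "('a, 'b) pre_digraph list \<Rightarrow> ('a, 'b) pre_digraph \<Rightarrow> bool" where
  single: "is_one_sum [G] G"
| step: "is_one_sum Gs H \<Longrightarrow> compatible H G \<Longrightarrow> card (verts H \<inter> verts G) = 1
           \<Longrightarrow> is_one_sum (Gs @ [G]) (union H G)"

end

theory Submission
  imports Defs
begin

text \<open>
  Normalise a linear functional that supports a facet to have maximum \<open>1\<close> on the polytope and
  to vanish at the apex. Its values at the other vertices turn out to be \<open>1\<close>, \<open>0\<close> and \<open>- 1\<close>, and facets correspond exactly to \<^emph>\<open>sign patterns\<close> on \<open>G\<close>: disjoint vertex sets \<open>A\<close>
  (value \<open>1\<close>) and \<open>B\<close> (value \<open>- 1\<close>) such that no edge joins \<open>A\<close> to \<open>B\<close> and every vertex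
  outside \<open>A \<union> B\<close> has a neighbour in \<open>A \<union> B\<close>. The first condition says that the functional is
  at most \<open>1\<close> on every \<open>e\<^sub>i - e\<^sub>j\<close>, the second that the \<open>e\<^sub>i - e\<^sub>j\<close> where it equals \<open>1\<close> span all
  the others, which is what a face needs in order to have codimension one
  (\<open>num_facets_suspension\<close>). The theorem thus becomes a count of sign patterns.

  For the lower bound, the set \<open>A\<close> can be arbitrary: completing it by all vertices that are
  neither in \<open>A\<close> nor adjacent to \<open>A\<close> gives a sign pattern. An edge leaves a second choice of \<open>B\<close>
  for \<open>A = {}\<close> (\<open>num_patterns_lower\<close>).

  For the upper bound, allow some vertices of the graph to be already restricted to two of the three
  values, as happens to the neighbours of a vertex whose value has been fixed. A restricted vertex
  contributes a factor of at most \<open>2\<close>, an unrestricted one a factor of at most \<open>sqrt 6\<close>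
  (\<open>card_sign_patterns_le\<close>). Indeed, for a vertex \<open>v\<close> of degree \<open>d\<close> in a graph with \<open>m\<close>
  vertices, splitting on the value of \<open>v\<close> bounds the count by
  \<open>sqrt 6 ^ (m - 1) + 2 * 2 ^ d * sqrt 6 ^ (m - 1 - d)\<close>. For \<open>d \<ge> 2\<close> this is at most
  \<open>7 / 3 * sqrt 6 ^ (m - 1)\<close>, which is less than \<open>sqrt 6 ^ m\<close>, and otherwise all degrees are at
  most \<open>1\<close> and the count is a product of factors \<open>6\<close> for edges and \<open>2\<close> for isolated vertices.
  So \<open>sqrt 6 ^ m\<close> is attained exactly by the perfect matchings.

  If \<open>m\<close> is odd there is no perfect matching. When all degrees are at most \<open>1\<close>, some vertex is
  isolated and the count is at most \<open>2 * sqrt 6 ^ (m - 1)\<close>; so the bound is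
  \<open>7 / 3 * sqrt 6 ^ (m - 1)\<close>, which is \<open>14 * sqrt 6 ^ (m - 3)\<close> for \<open>m \<ge> 3\<close>.
  It is attained only if there is a vertex \<open>v\<close> of degree \<open>2\<close> whose removal leaves a perfect matching
  and whose neighbours never both vanish, which forces them to be matched to each other: \<open>v\<close> lies
  in a triangle
  (\<open>num_patterns_odd_eq_iff\<close>).
\<close>

section \<open>Sign patterns on a graph\<close>

text \<open>
  The parameters \<open>P\<close> and \<open>M\<close> describe the state after some vertices have been given a value and
  removed: \<open>P\<close> are the vertices next to a removed positive vertex, \<open>M\<close> those next to a
  removed negative one. The former may no longer be negative, the latter no longer positive, and
  both already have the nonzero neighbour that a zero needs.
\<close>
definition sign_patterns :: "'a rel \<Rightarrow> 'a set \<Rightarrow> 'a set \<Rightarrow> 'a set \<Rightarrow> ('a set \<times> 'a set) set" where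
  "sign_patterns E V P M =
     {(A, B). A \<subseteq> V - M \<and> B \<subseteq> V - P \<and> A \<inter> B = {} \<and> (\<forall>a\<in>A. \<forall>b\<in>B. (a, b) \<notin> E) \<and>
        (\<forall>v\<in>V - (P \<union> M \<union> A \<union> B). \<exists>u\<in>A \<union> B. (v, u) \<in> E)}"

abbreviation num_patterns :: "'a rel \<Rightarrow> 'a set \<Rightarrow> nat" where
  "num_patterns E V \<equiv> card (sign_patterns E V {} {})"

abbreviation patterns_meeting :: "'a rel \<Rightarrow> 'a set \<Rightarrow> 'a set \<Rightarrow> ('a set \<times> 'a set) set" where
  "patterns_meeting E V N \<equiv> {(A, B) \<in> sign_patterns E V {} {}. N \<inter> (A \<union> B) \<noteq> {}}"

lemma finite_sign_patterns: "finite V \<Longrightarrow> finite (sign_patterns E V P M)"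
  by (rule finite_subset[of _ "Pow V \<times> Pow V"]) (auto simp: sign_patterns_def)

lemma sign_patterns_Int: "sign_patterns E V (V \<inter> P) (V \<inter> M) = sign_patterns E V P M"
  by (auto simp: sign_patterns_def)

lemma sign_patternsD:
  assumes "(A, B) \<in> sign_patterns E V P M"
  shows "A \<subseteq> V - M" "B \<subseteq> V - P" "A \<inter> B = {}" "\<And>a b. a \<in> A \<Longrightarrow> b \<in> B \<Longrightarrow> (a, b) \<notin> E"
    "\<And>v. v \<in> V - (P \<union> M \<union> A \<union> B) \<Longrightarrow> \<exists>u\<in>A \<union> B. (v, u) \<in> E"
  using assms by (auto simp: sign_patterns_def)

lemma sign_patternsI:
  assumes "A \<subseteq> V - M" "B \<subseteq> V - P" "A \<inter> B = {}" "\<And>a b. a \<in> A \<Longrightarrow> b \<in> B \<Longrightarrow> (a, b) \<notin> E"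
    "\<And>v. v \<in> V \<Longrightarrow> v \<notin> P \<Longrightarrow> v \<notin> M \<Longrightarrow> v \<notin> A \<Longrightarrow> v \<notin> B \<Longrightarrow> \<exists>u\<in>A \<union> B. (v, u) \<in> E"
  shows "(A, B) \<in> sign_patterns E V P M"
  using assms by (auto simp: sign_patterns_def)

lemma sign_patterns_swap:
  assumes "sym E" "(A, B) \<in> sign_patterns E V P M"
  shows "(B, A) \<in> sign_patterns E V M P"
  using assms(1) sign_patternsD[OF assms(2)]
  by (intro sign_patternsI) (auto dest: symD simp: Un_ac)

lemma card_sign_patterns_swap:
  assumes "sym E"
  shows "card (sign_patterns E V M P) = card (sign_patterns E V P M)"
proof -
  have "prod.swap ` sign_patterns E V P M = sign_patterns E V M P"
    using sign_patterns_swap[OF assms] by (force simp: image_iff)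
  then show ?thesis
    by (metis card_image inj_swap subset_UNIV inj_on_subset)
qed

text \<open>
  Taking \<open>B\<close> as large as \<open>A\<close> permits is a section of the map \<open>(A, B) \<mapsto> A\<close>, which gives the
  bound. If \<open>u\<close> lies on an edge, then \<open>({}, V - {u})\<close> is a pattern that this section misses.
\<close>
lemma num_patterns_lower:
  assumes "finite V" "sym E" "irrefl E" "E \<subseteq> V \<times> V"
  shows "2 ^ card V \<le> num_patterns E V"
    and "num_patterns E V = 2 ^ card V \<longleftrightarrow> E = {}"
proof -
  define g where "g A = (A, V - (A \<union> E `` A))" for A
  have inj: "inj_on g (Pow V)" by (auto simp: g_def inj_on_def)
  have sub: "g ` Pow V \<subseteq> sign_patterns E V {} {}"
  proof clarsimp
    fix A assume "A \<subseteq> V"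
    have "(A, V - (A \<union> E `` A)) \<in> sign_patterns E V {} {}"
    proof (rule sign_patternsI)
      fix v assume "v \<in> V" "v \<notin> A" "v \<notin> V - (A \<union> E `` A)"
      then obtain a where "a \<in> A" "(a, v) \<in> E" by blast
      then show "\<exists>u\<in>A \<union> (V - (A \<union> E `` A)). (v, u) \<in> E" using symD[OF assms(2)] by blast
    qed (use \<open>A \<subseteq> V\<close> in blast)+
    then show "g A \<in> sign_patterns E V {} {}" by (simp add: g_def)
  qed
  have fin: "finite (sign_patterns E V {} {})" by (rule finite_sign_patterns[OF assms(1)])
  have c: "card (g ` Pow V) = 2 ^ card V" using inj assms(1) by (simp add: card_image card_Pow)
  show "2 ^ card V \<le> num_patterns E V" using card_mono[OF fin sub] c by simp
  show "num_patterns E V = 2 ^ card V \<longleftrightarrow> E = {}"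
  proof
    assume eq: "num_patterns E V = 2 ^ card V"
    have im: "g ` Pow V = sign_patterns E V {} {}"
      using card_subset_eq[OF fin sub] c eq by simp
    show "E = {}"
    proof (rule ccontr)
      assume "E \<noteq> {}"
      then obtain u v where uv: "(u, v) \<in> E" by auto
      have "({}, V - {u}) \<in> sign_patterns E V {} {}"
        using uv assms by (auto simp: sign_patterns_def irrefl_def)
      then have "({}, V - {u}) \<in> g ` Pow V" using im by simp
      then show False using uv assms by (auto simp: g_def)
    qed
  next
    assume "E = {}"
    have "(A, B) \<in> g ` Pow V" if "(A, B) \<in> sign_patterns E V {} {}" for A B
    proof -
      have "A \<subseteq> V" "B = V - A" using sign_patternsD[OF that] \<open>E = {}\<close> by blast+
      then show ?thesis using \<open>E = {}\<close> by (simp add: g_def)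
    qed
    then have "g ` Pow V = sign_patterns E V {} {}" using sub by auto
    then show "num_patterns E V = 2 ^ card V" using c by simp
  qed
qed

text \<open>
  A vertex of \<open>P\<close> is zero, and then has no influence on the others, or positive, and
  then its neighbours join \<open>P\<close>.
\<close>
lemma card_sign_patterns_split:
  assumes fin: "finite V" and E: "sym E" "irrefl E" and p: "p \<in> V" "p \<in> P" "p \<notin> M"
  shows "card (sign_patterns E V P M) \<le>
    card (sign_patterns E (V - {p}) P M) + card (sign_patterns E (V - {p}) (P \<union> E `` {p}) M)"
proof -
  let ?Q = "sign_patterns E V P M"
  let ?out = "{(A, B) \<in> ?Q. p \<notin> A}" and ?ins = "{(A, B) \<in> ?Q. p \<in> A}"
  have fQ: "finite ?Q" by (rule finite_sign_patterns[OF fin])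
  have "?out \<subseteq> sign_patterns E (V - {p}) P M"
    using p by (auto simp: sign_patterns_def)
  then have 0: "card ?out \<le> card (sign_patterns E (V - {p}) P M)"
    by (intro card_mono finite_sign_patterns finite_Diff fin)
  let ?h = "\<lambda>(A, B). (A - {p}, B)"
  have "inj_on ?h ?ins" by (auto simp: inj_on_def)
  moreover have "?h ` ?ins \<subseteq> sign_patterns E (V - {p}) (P \<union> E `` {p}) M"
  proof clarify
    fix A B assume AB: "(A, B) \<in> ?Q" "p \<in> A"
    note D = sign_patternsD[OF AB(1)]
    show "(A - {p}, B) \<in> sign_patterns E (V - {p}) (P \<union> E `` {p}) M"
    proof (rule sign_patternsI)
      fix v assume "v \<in> V - {p}" "v \<notin> P \<union> E `` {p}" "v \<notin> M" "v \<notin> A - {p}" "v \<notin> B"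
      then show "\<exists>u\<in>A - {p} \<union> B. (v, u) \<in> E" using D(5)[of v] E(1) by (auto dest: symD)
    qed (use D AB(2) p in blast)+
  qed
  ultimately have 1: "card ?ins \<le> card (sign_patterns E (V - {p}) (P \<union> E `` {p}) M)"
    by (meson card_inj_on_le finite_sign_patterns fin finite_Diff)
  have "?Q = ?out \<union> ?ins" by auto
  then have "card ?Q \<le> card ?out + card ?ins" using card_Un_le[of ?out ?ins] by argo
  then show ?thesis using 0 1 by linarith
qed

text \<open>
  The summands count the patterns in which \<open>v\<close> is zero and those in which it is nonzero; the factor
  \<open>2\<close> is the symmetry exchanging the two signs. Equality, rather than an upper bound, is what
  makes it possible to count exactly on complete graphs.
\<close>
lemma num_patterns_split:
  assumes fin: "finite V" and E: "sym E" "irrefl E" and v: "v \<in> V"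
  shows "num_patterns E V =
    card (patterns_meeting E (V - {v}) (E `` {v})) +
    2 * card (sign_patterns E (V - {v}) (E `` {v}) {})"
proof -
  let ?Q = "sign_patterns E V {} {}"
  let ?Z = "{(A, B) \<in> ?Q. v \<notin> A \<union> B}" and ?A = "{(A, B) \<in> ?Q. v \<in> A}"
    and ?B = "{(A, B) \<in> ?Q. v \<in> B}"
  have fQ: "finite ?Q" by (rule finite_sign_patterns[OF fin])
  have fs: "finite ?Z" "finite ?A" "finite ?B" by (rule finite_subset[OF _ fQ]; auto)+
  have "(A, B) \<in> ?Q \<and> v \<notin> A \<union> B \<longleftrightarrow>
      (A, B) \<in> sign_patterns E (V - {v}) {} {} \<and> E `` {v} \<inter> (A \<union> B) \<noteq> {}" for A B
    using v unfolding sign_patterns_def by blast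
  then have Z: "?Z = patterns_meeting E (V - {v}) (E `` {v})"
    by blast
  have A: "card ?A = card (sign_patterns E (V - {v}) (E `` {v}) {})"
  proof (rule bij_betw_same_card[of "\<lambda>(A, B). (A - {v}, B)"],
      rule bij_betw_byWitness[where f' = "\<lambda>(A, B). (insert v A, B)"])
    show "(\<lambda>(A, B). (A - {v}, B)) ` ?A \<subseteq> sign_patterns E (V - {v}) (E `` {v}) {}"
    proof clarify
      fix A B assume AB: "(A, B) \<in> ?Q" "v \<in> A"
      note D = sign_patternsD[OF AB(1)]
      show "(A - {v}, B) \<in> sign_patterns E (V - {v}) (E `` {v}) {}"
      proof (rule sign_patternsI)
        fix w assume "w \<in> V - {v}" "w \<notin> E `` {v}" "w \<notin> A - {v}" "w \<notin> B"
        then show "\<exists>u\<in>A - {v} \<union> B. (w, u) \<in> E" using D(5)[of w] E(1) by (auto dest: symD)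
      qed (use D AB(2) in blast)+
    qed
    show "(\<lambda>(A, B). (insert v A, B)) ` sign_patterns E (V - {v}) (E `` {v}) {} \<subseteq> ?A"
    proof clarify
      fix A B assume AB: "(A, B) \<in> sign_patterns E (V - {v}) (E `` {v}) {}"
      note D = sign_patternsD[OF AB]
      have "(insert v A, B) \<in> ?Q"
      proof (rule sign_patternsI)
        fix w assume "w \<in> V" "w \<notin> insert v A" "w \<notin> B"
        then show "\<exists>u\<in>insert v A \<union> B. (w, u) \<in> E" using D(5)[of w] E(1) by (auto dest: symD)
      next
        fix a b assume "a \<in> insert v A" "b \<in> B"
        then show "(a, b) \<notin> E" using D(2) D(4)[of a b] by blast
      qed (use D v in blast)+
      then show "(insert v A, B) \<in> ?Q \<and> v \<in> insert v A" by blast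
    qed
  qed (auto simp: sign_patterns_def)
  have BA: "card ?B = card ?A"
  proof -
    have "prod.swap ` ?A = ?B"
      using sign_patterns_swap[OF E(1)] by (force simp: image_iff)
    moreover have "inj_on prod.swap ?A" by simp
    ultimately show ?thesis using card_image[of prod.swap ?A] by argo
  qed
  have disj: "A \<inter> B = {}" if "(A, B) \<in> ?Q" for A B using sign_patternsD(3)[OF that] .
  have "?Q = ?Z \<union> ?A \<union> ?B" by blast
  moreover have "?Z \<inter> ?A = {}" "(?Z \<union> ?A) \<inter> ?B = {}"
    using disj by blast+
  ultimately have "card ?Q = card ?Z + card ?A + card ?B"
    using fs card_Un_disjoint[of "?Z \<union> ?A" ?B] card_Un_disjoint[of ?Z ?A] by (simp only: finite_Un)
  then show ?thesis using A BA unfolding Z by linarith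
qed

lemma num_patterns_Un:
  assumes fin: "finite V" "finite W" and "V \<inter> W = {}" and E: "sym E" "E \<inter> V \<times> W = {}"
  shows "num_patterns E (V \<union> W) = num_patterns E V * num_patterns E W"
proof -
  let ?f = "\<lambda>((A, B), (C, D)). (A \<union> C, B \<union> D)"
  let ?g = "\<lambda>(A, B). ((A \<inter> V, B \<inter> V), (A \<inter> W, B \<inter> W))"
  have E': "(v, w) \<notin> E" "(w, v) \<notin> E" if "v \<in> V" "w \<in> W" for v w
    using E that by (auto simp: sym_def)
  have "bij_betw ?g (sign_patterns E (V \<union> W) {} {}) (sign_patterns E V {} {} \<times> sign_patterns E W {} {})"
  proof (rule bij_betw_byWitness[where f' = ?f])
    show "\<forall>a\<in>sign_patterns E (V \<union> W) {} {}. ?f (?g a) = a"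
      by (auto simp: sign_patterns_def)
    show "\<forall>a\<in>sign_patterns E V {} {} \<times> sign_patterns E W {} {}. ?g (?f a) = a"
      using assms(3) by (auto simp: sign_patterns_def)
    show "?g ` sign_patterns E (V \<union> W) {} {} \<subseteq> sign_patterns E V {} {} \<times> sign_patterns E W {} {}"
    proof clarsimp
      fix A B assume AB: "(A, B) \<in> sign_patterns E (V \<union> W) {} {}"
      have "\<exists>u\<in>(A \<inter> V) \<union> (B \<inter> V). (x, u) \<in> E" if "x \<in> V - (A \<inter> V \<union> B \<inter> V)" for x
      proof -
        obtain u where "u \<in> A \<union> B" "(x, u) \<in> E" using AB \<open>x \<in> _\<close> unfolding sign_patterns_def by blast
        moreover have "u \<in> V \<union> W" using AB \<open>u \<in> A \<union> B\<close> unfolding sign_patterns_def by blast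
        ultimately show ?thesis using E' that by blast
      qed
      moreover have "\<exists>u\<in>(A \<inter> W) \<union> (B \<inter> W). (x, u) \<in> E" if "x \<in> W - (A \<inter> W \<union> B \<inter> W)" for x
      proof -
        obtain u where "u \<in> A \<union> B" "(x, u) \<in> E" using AB \<open>x \<in> _\<close> unfolding sign_patterns_def by blast
        moreover have "u \<in> V \<union> W" using AB \<open>u \<in> A \<union> B\<close> unfolding sign_patterns_def by blast
        ultimately show ?thesis using E' that by blast
      qed
      ultimately show "(A \<inter> V, B \<inter> V) \<in> sign_patterns E V {} {} \<and> (A \<inter> W, B \<inter> W) \<in> sign_patterns E W {} {}"
        using AB unfolding sign_patterns_def by auto
    qed
    show "?f ` (sign_patterns E V {} {} \<times> sign_patterns E W {} {}) \<subseteq> sign_patterns E (V \<union> W) {} {}"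
    proof clarsimp
      fix A B C D assume AB: "(A, B) \<in> sign_patterns E V {} {}" "(C, D) \<in> sign_patterns E W {} {}"
      note D = sign_patternsD[OF AB(1)] sign_patternsD[OF AB(2)]
      show "(A \<union> C, B \<union> D) \<in> sign_patterns E (V \<union> W) {} {}"
      proof (rule sign_patternsI)
        fix a b assume "a \<in> A \<union> C" "b \<in> B \<union> D"
        then show "(a, b) \<notin> E" using D E' by blast
      next
        fix v assume "v \<in> V \<union> W" "v \<notin> A \<union> C" "v \<notin> B \<union> D"
        then show "\<exists>u\<in>(A \<union> C) \<union> (B \<union> D). (v, u) \<in> E" using D(5)[of v] D(10)[of v] by blast
      qed (use D assms(3) in blast)+
    qed
  qed
  then show ?thesis by (simp add: bij_betw_same_card card_cartesian_product)
qed

section \<open>The upper bound on the number of sign patterns\<close>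

text \<open>
  The bound for graphs in which the vertices of \<open>X\<close> are restricted.
\<close>
definition pattern_weight :: "'a set \<Rightarrow> 'a set \<Rightarrow> real" where
  "pattern_weight V X = (\<Prod>v\<in>V. if v \<in> X then 2 else sqrt 6)"

text \<open>
  The strict gap that makes a vertex of degree at least \<open>2\<close> wasteful: \<open>7 / 3 = 1 + 4 / 3\<close>
  bounds the factor which such a vertex contributes.
\<close>
lemma sqrt6_gt: "7 / 3 < sqrt 6"
  by (rule real_less_rsqrt) (simp add: power2_eq_square)

lemma sqrt6_power_add_2: "m + 2 = n \<Longrightarrow> sqrt 6 ^ n = 6 * sqrt 6 ^ m"
  by (auto simp: power_add)

lemma sqrt6_power_even: "sqrt 6 ^ (2 * j) = 6 ^ j"
  by (simp add: power_mult)

lemma pattern_weight_nonneg: "0 \<le> pattern_weight V X"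
  unfolding pattern_weight_def by (rule prod_nonneg) auto

lemma pattern_weight_antimono: "X \<subseteq> Y \<Longrightarrow> pattern_weight V Y \<le> pattern_weight V X"
  unfolding pattern_weight_def using sqrt6_gt by (intro prod_mono) auto

lemma pattern_weight_remove:
  "finite V \<Longrightarrow> v \<in> V \<Longrightarrow>
    pattern_weight V X = (if v \<in> X then 2 else sqrt 6) * pattern_weight (V - {v}) X"
  unfolding pattern_weight_def by (rule prod.remove)

lemma pattern_weight_eq:
  assumes "finite V"
  shows "pattern_weight V X = 2 ^ card (V \<inter> X) * sqrt 6 ^ card (V - X)"
proof -
  have "pattern_weight V X = (\<Prod>v\<in>V \<inter> X. 2) * (\<Prod>v\<in>V - X. sqrt 6)"
    unfolding pattern_weight_def using assms by (simp add: prod.If_cases Diff_eq)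
  then show ?thesis by simp
qed

lemma pattern_weight_empty: "finite V \<Longrightarrow> pattern_weight V {} = sqrt 6 ^ card V"
  by (simp add: pattern_weight_eq)

lemma card_sign_patterns_forced:
  assumes "finite V" "V \<subseteq> P"
  shows "card (sign_patterns E V P {}) = 2 ^ card V"
proof -
  have "sign_patterns E V P {} = (\<lambda>A. (A, {})) ` Pow V"
    using assms by (auto simp: sign_patterns_def)
  then show ?thesis using assms(1) by (simp add: card_image inj_on_def card_Pow)
qed

lemma num_patterns_empty: "num_patterns E {} = 1"
  using card_sign_patterns_forced[of "{}" "{}"] by simp

lemma card_meeting_patterns_le:
  "finite V \<Longrightarrow> card (patterns_meeting E V N) \<le> num_patterns E V"
  by (rule card_mono) (auto simp: finite_sign_patterns)

context
  fixes E :: "'a rel"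
  assumes sym_E: "sym E" and irrefl_E: "irrefl E"
begin

text \<open>
  On a complete graph all nonzero values agree, and not all values vanish. The counts \<open>6\<close> for an
  edge and \<open>14\<close> for a triangle are the instances that matter.
\<close>
lemma num_patterns_complete:
  assumes "finite V" "V \<noteq> {}" "\<And>u v. u \<in> V \<Longrightarrow> v \<in> V \<Longrightarrow> u \<noteq> v \<Longrightarrow> (u, v) \<in> E"
  shows "num_patterns E V + 2 = 2 ^ (card V + 1)"
  using assms
proof (induction V rule: finite_ne_induct)
  case (singleton v)
  have "patterns_meeting E ({v} - {v}) (E `` {v}) = {}"
    by (auto simp: sign_patterns_def)
  then have "num_patterns E {v} = 2"
    using num_patterns_split[OF _ sym_E irrefl_E, of "{v}" v]
      card_sign_patterns_forced[of "{v} - {v}" "E `` {v}"]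
    by (simp only:) simp
  then show ?case by simp
next
  case (insert v V)
  have V: "insert v V - {v} = V" using insert.hyps by auto
  have nb: "V \<subseteq> E `` {v}" using insert.prems insert.hyps by auto
  have "E `` {v} \<inter> (A \<union> B) \<noteq> {}" if "(A, B) \<in> sign_patterns E V {} {}" for A B
  proof -
    obtain x where "x \<in> V" using insert.hyps(2) by auto
    moreover have "A \<union> B \<subseteq> V" using sign_patternsD(1,2)[OF that] by blast
    ultimately have "\<exists>u\<in>V. u \<in> A \<union> B" using sign_patternsD(5)[OF that, of x] by blast
    then show ?thesis using nb by blast
  qed
  then have "patterns_meeting E V (E `` {v}) = sign_patterns E V {} {}"
    by auto
  then have "num_patterns E (insert v V) = num_patterns E V + 2 * 2 ^ card V"
    using num_patterns_split[OF _ sym_E irrefl_E, of "insert v V" v] insert.hyps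
      card_sign_patterns_forced[OF insert.hyps(1) nb] V
    by (simp only: V finite_insert insertI1 simp_thms)
  then show ?case using insert by simp
qed

lemma num_patterns_isolated:
  assumes "finite V" "v \<in> V" "E `` {v} \<inter> V = {}"
  shows "num_patterns E V = 2 * num_patterns E (V - {v})"
proof -
  have "num_patterns E ({v} \<union> (V - {v})) = num_patterns E {v} * num_patterns E (V - {v})"
    using assms sym_E by (intro num_patterns_Un) auto
  then show ?thesis using assms num_patterns_complete[of "{v}"] by (simp add: insert_absorb)
qed

lemma num_patterns_edge:
  assumes "finite V" "v \<in> V" "E `` {v} \<inter> V = {w}" "E `` {w} \<inter> V = {v}"
  shows "num_patterns E V = 6 * num_patterns E (V - {v, w})"
proof -
  have vw: "w \<in> V" "(v, w) \<in> E" "(w, v) \<in> E"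
  proof -
    have "w \<in> E `` {v} \<inter> V" "v \<in> E `` {w} \<inter> V" unfolding assms(3,4) by simp_all
    then show "w \<in> V" "(v, w) \<in> E" "(w, v) \<in> E" by simp_all
  qed
  have cut: "x \<in> {v, w}" if "(v, x) \<in> E \<or> (w, x) \<in> E" "x \<in> V" for x
  proof -
    have "x \<in> E `` {v} \<inter> V \<or> x \<in> E `` {w} \<inter> V" using that by simp
    then show ?thesis unfolding assms(3,4) by auto
  qed
  have "v \<noteq> w" using vw irrefl_E by (auto simp: irrefl_def)
  have "num_patterns E ({v, w} \<union> (V - {v, w})) = num_patterns E {v, w} * num_patterns E (V - {v, w})"
  proof (rule num_patterns_Un)
    show "E \<inter> {v, w} \<times> (V - {v, w}) = {}" using cut by blast
  qed (use assms(1) sym_E in auto)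
  moreover have "{v, w} \<union> (V - {v, w}) = V" using assms(2) vw by auto
  moreover have "num_patterns E {v, w} = 6"
    using num_patterns_complete[of "{v, w}"] vw \<open>v \<noteq> w\<close> by auto
  ultimately show ?thesis by simp
qed

lemma max_degree_1_partner:
  assumes fin: "finite V" and deg: "\<And>v. v \<in> V \<Longrightarrow> card (E `` {v} \<inter> V) \<le> 1"
    and v: "v \<in> V" "E `` {v} \<inter> V \<noteq> {}"
  obtains w where "w \<in> V" "v \<noteq> w" "E `` {v} \<inter> V = {w}" "E `` {w} \<inter> V = {v}"
proof -
  obtain w where w: "w \<in> V" "(v, w) \<in> E" using v by auto
  then have wv: "(w, v) \<in> E" using sym_E by (auto dest: symD)
  have "E `` {v} \<inter> V = {w}"
    by (rule card_seteq[symmetric]) (use deg[OF v(1)] fin w in auto)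
  moreover have "E `` {w} \<inter> V = {v}"
    by (rule card_seteq[symmetric]) (use deg[OF w(1)] fin wv v in auto)
  moreover have "v \<noteq> w" using w irrefl_E by (auto simp: irrefl_def)
  ultimately show thesis using that w by blast
qed

text \<open>
  Each restricted neighbour of \<open>v\<close> trades a factor \<open>sqrt 6\<close> for \<open>2\<close>. Two of them turn the
  contribution \<open>2 * sqrt 6 ^ (card V - 1)\<close> of the nonzero values of \<open>v\<close> into
  \<open>4 / 3 * sqrt 6 ^ (card V - 1)\<close>, three of them into something strictly smaller. The weight
  bound for \<open>V - {v}\<close> is a hypothesis because the lemma serves in the induction that
  proves the weight bound.
\<close>
lemma num_patterns_high_degree:
  assumes fin: "finite V" and v: "v \<in> V" and d: "2 \<le> card (E `` {v} \<inter> V)"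
    and bound: "real (card (sign_patterns E (V - {v}) (E `` {v}) {})) \<le> pattern_weight (V - {v}) (E `` {v})"
  shows "real (num_patterns E V) \<le>
      card (patterns_meeting E (V - {v}) (E `` {v})) + 4 / 3 * sqrt 6 ^ (card V - 1)"
    and "3 \<le> card (E `` {v} \<inter> V) \<Longrightarrow> real (num_patterns E V) <
      card (patterns_meeting E (V - {v}) (E `` {v})) + 4 / 3 * sqrt 6 ^ (card V - 1)"
proof -
  let ?Z = "patterns_meeting E (V - {v}) (E `` {v})"
  let ?d = "card (E `` {v} \<inter> V)"
  have eq: "(V - {v}) \<inter> E `` {v} = E `` {v} \<inter> V" using irrefl_E by (auto simp: irrefl_def)
  have "card V - 1 = card ((V - {v}) \<inter> E `` {v}) + card ((V - {v}) - E `` {v})"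
    using fin v by (metis card_Diff_singleton card_Int_Diff finite_Diff)
  then have cV: "card V - 1 = ?d + card ((V - {v}) - E `` {v})" by (simp only: eq)
  let ?r = "card ((V - {v}) - E `` {v})"
  have w: "pattern_weight (V - {v}) (E `` {v}) = 2 ^ ?d * sqrt 6 ^ ?r"
    using pattern_weight_eq[of "V - {v}" "E `` {v}"] fin by (simp add: eq)
  have N: "real (num_patterns E V) \<le> card ?Z + 2 * (2 ^ ?d * sqrt 6 ^ ?r)"
    using num_patterns_split[OF fin sym_E irrefl_E v] bound w by simp
  obtain k where k: "?d = 2 + k" using d le_Suc_ex by blast
  have eq1: "4 / 3 * sqrt 6 ^ (card V - 1) = 8 * sqrt 6 ^ k * sqrt 6 ^ ?r"
    unfolding cV k by (simp add: power_add)
  moreover have eq2: "2 * (2 ^ ?d * sqrt 6 ^ ?r) = 8 * 2 ^ k * sqrt 6 ^ ?r"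
    unfolding k by (simp add: power_add)
  moreover have le: "8 * 2 ^ k * sqrt 6 ^ ?r \<le> 8 * sqrt 6 ^ k * sqrt 6 ^ ?r"
    using sqrt6_gt by (intro mult_right_mono mult_left_mono power_mono) auto
  ultimately show "real (num_patterns E V) \<le> card ?Z + 4 / 3 * sqrt 6 ^ (card V - 1)"
    using N by linarith
  assume "3 \<le> ?d"
  then have "(2::real) ^ k < sqrt 6 ^ k" using sqrt6_gt k by (intro power_strict_mono) auto
  then have "8 * 2 ^ k * sqrt 6 ^ ?r < 8 * sqrt 6 ^ k * sqrt 6 ^ ?r"
    by (intro mult_strict_right_mono mult_strict_left_mono) auto
  then show "real (num_patterns E V) < card ?Z + 4 / 3 * sqrt 6 ^ (card V - 1)"
    using N eq1 eq2 by linarith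
qed

text \<open>
  Restricted vertices are removed first; each leaves at most two cases, and each case is bounded
  by the weight of the remaining vertices, because restricting some of them only lowers it. When none is left, a vertex
  of degree at least \<open>2\<close> is removed if there is one, and otherwise an isolated vertex or an edge.
\<close>
lemma card_sign_patterns_le:
  assumes "finite V"
  shows "real (card (sign_patterns E V P M)) \<le> pattern_weight V (P \<union> M)"
  using assms
proof (induction "card V" arbitrary: V P M rule: less_induct)
  case less
  note fin = \<open>finite V\<close>
  have smaller: "card (V - X) < card V" if "v \<in> X" "v \<in> V" for X v
    using that fin by (metis Diff_iff Diff_subset psubsetI psubset_card_mono)
  have IH: "real (card (sign_patterns E (V - X) P M)) \<le> pattern_weight (V - X) (P \<union> M)"
    if "v \<in> X" "v \<in> V" for X v P M
    using less.hyps[OF smaller[OF that]] fin by simp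
  have half: "real (card (sign_patterns E V P M)) \<le> pattern_weight V (P \<union> M)"
    if p: "p \<in> V" "p \<in> P" "p \<notin> M" for p P M
  proof -
    have "real (card (sign_patterns E V P M)) \<le> card (sign_patterns E (V - {p}) P M)
        + card (sign_patterns E (V - {p}) (P \<union> E `` {p}) M)"
      using card_sign_patterns_split[OF fin sym_E irrefl_E p] by linarith
    also have "\<dots> \<le> pattern_weight (V - {p}) (P \<union> M) + pattern_weight (V - {p}) ((P \<union> E `` {p}) \<union> M)"
      unfolding of_nat_add using IH[of p "{p}"] p by (intro add_mono) auto
    also have "\<dots> \<le> pattern_weight (V - {p}) (P \<union> M) + pattern_weight (V - {p}) (P \<union> M)"
      by (intro add_left_mono pattern_weight_antimono) auto
    also have "\<dots> = pattern_weight V (P \<union> M)"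
      using pattern_weight_remove[OF fin p(1), of "P \<union> M"] p by simp
    finally show ?thesis .
  qed
  consider p where "p \<in> V" "p \<in> P" "p \<notin> M" | p where "p \<in> V" "p \<in> M" "p \<notin> P"
    | p where "p \<in> V" "p \<in> P" "p \<in> M" | "V \<inter> P = {}" "V \<inter> M = {}" by auto
  then show ?case
  proof cases
    case 1
    then show ?thesis by (rule half)
  next
    case 2
    then show ?thesis using half[OF 2] card_sign_patterns_swap[OF sym_E, of V M P] by (simp add: Un_commute)
  next
    case (3 p)
    have "sign_patterns E V P M \<subseteq> sign_patterns E (V - {p}) P M"
      using 3 by (auto simp: sign_patterns_def)
    then have "card (sign_patterns E V P M) \<le> card (sign_patterns E (V - {p}) P M)"
      by (intro card_mono finite_sign_patterns finite_Diff fin)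
    also have "real \<dots> \<le> pattern_weight (V - {p}) (P \<union> M)"
      using IH[of p "{p}"] 3 by auto
    also have "\<dots> \<le> pattern_weight V (P \<union> M)"
      using pattern_weight_remove[OF fin 3(1), of "P \<union> M"] 3 pattern_weight_nonneg[of "V - {p}" "P \<union> M"]
      by simp
    finally show ?thesis by simp
  next
    case 4
    have Q: "sign_patterns E V P M = sign_patterns E V {} {}"
      using sign_patterns_Int[of E V P M] 4 by simp
    have "V \<inter> (P \<union> M) = {}" "V - (P \<union> M) = V" using 4 by auto
    then have W: "pattern_weight V (P \<union> M) = sqrt 6 ^ card V"
      by (simp add: pattern_weight_eq[OF fin])
    have IH0: "real (num_patterns E (V - X)) \<le> sqrt 6 ^ card (V - X)" if "v \<in> X" "v \<in> V" for X v
      using IH[OF that, of "{}" "{}"] fin by (simp add: pattern_weight_empty)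
    have "real (num_patterns E V) \<le> sqrt 6 ^ card V"
    proof (cases "\<exists>v\<in>V. 2 \<le> card (E `` {v} \<inter> V)")
      case True
      then obtain v where v: "v \<in> V" "2 \<le> card (E `` {v} \<inter> V)" by blast
      have "real (card (sign_patterns E (V - {v}) (E `` {v}) {})) \<le> pattern_weight (V - {v}) (E `` {v})"
        using IH[of v "{v}" "E `` {v}" "{}"] v by simp
      note num_patterns_high_degree(1)[OF fin v this]
      moreover have "real (card (patterns_meeting E (V - {v}) (E `` {v})))
          \<le> sqrt 6 ^ (card V - 1)"
        using card_meeting_patterns_le[of "V - {v}" E "E `` {v}"] IH0[of v "{v}"] v fin by simp
      ultimately have "real (num_patterns E V) \<le> 7 / 3 * sqrt 6 ^ (card V - 1)" by simp
      also have "\<dots> \<le> sqrt 6 * sqrt 6 ^ (card V - 1)"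
        using sqrt6_gt by (intro mult_right_mono) auto
      also have "\<dots> = sqrt 6 ^ card V"
        using v fin by (cases "card V") auto
      finally show ?thesis .
    next
      case False
      then have deg: "card (E `` {v} \<inter> V) \<le> 1" if "v \<in> V" for v using that by force
      show ?thesis
      proof (cases "V = {}")
        case True
        then show ?thesis using num_patterns_empty[of E] by simp
      next
        case nonempty: False
        then obtain v where v: "v \<in> V" by blast
        show ?thesis
        proof (cases "E `` {v} \<inter> V = {}")
          case True
          have "real (num_patterns E V) \<le> 2 * sqrt 6 ^ (card V - 1)"
          proof -
            have "card (V - {v}) = card V - 1" using v by simp
            then have "real (num_patterns E (V - {v})) \<le> sqrt 6 ^ (card V - 1)"
              using IH0[OF singletonI v] by (simp only:)
            then show ?thesis unfolding num_patterns_isolated[OF fin v True] by linarith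
          qed
          also have "\<dots> \<le> sqrt 6 * sqrt 6 ^ (card V - 1)"
            using sqrt6_gt by (intro mult_right_mono) auto
          also have "\<dots> = sqrt 6 ^ card V"
            using v fin by (cases "card V") auto
          finally show ?thesis .
        next
          case False
          obtain w where w: "w \<in> V" "v \<noteq> w" "E `` {v} \<inter> V = {w}" "E `` {w} \<inter> V = {v}"
            using max_degree_1_partner[OF fin deg v False] by blast
          have "card (V - {v, w}) + 2 = card V"
            using v w fin card_mono[of V "{v, w}"] by (simp add: card_Diff_subset)
          then have "sqrt 6 ^ card V = 6 * sqrt 6 ^ card (V - {v, w})"
            by (rule sqrt6_power_add_2)
          then show ?thesis
            unfolding num_patterns_edge[OF fin v w(3,4)] using IH0[OF _ v, of "{v, w}"] by simp
        qed
      qed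
    qed
    then show ?thesis using Q W by simp
  qed
qed

end

section \<open>Graphs with the maximal number of sign patterns\<close>
definition matched :: "'a rel \<Rightarrow> 'a set \<Rightarrow> bool" where
  "matched E V \<longleftrightarrow> (\<forall>v\<in>V. \<exists>w. E `` {v} \<inter> V = {w})"

definition matched_with_triangle :: "'a rel \<Rightarrow> 'a set \<Rightarrow> bool" where
  "matched_with_triangle E V \<longleftrightarrow>
     (\<exists>T\<subseteq>V. card T = 3 \<and> (\<forall>v\<in>T. E `` {v} \<inter> V = T - {v}) \<and> matched E (V - T))"

lemma matched_max_degree_1: "matched E V \<Longrightarrow> v \<in> V \<Longrightarrow> card (E `` {v} \<inter> V) \<le> 1"
  unfolding matched_def by fastforce

context
  fixes E :: "'a rel"
  assumes sym_E: "sym E" and irrefl_E: "irrefl E"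
begin

lemma num_patterns_le_sqrt6_power:
  assumes "finite V"
  shows "real (num_patterns E V) \<le> sqrt 6 ^ card V"
  using card_sign_patterns_le[OF sym_E irrefl_E assms, of "{}" "{}"] assms
  by (simp add: pattern_weight_empty)

text \<open>
  Such a graph consists of \<open>i\<close> isolated vertices and \<open>j\<close> disjoint edges.
\<close>
lemma num_patterns_max_degree_1:
  assumes "finite V" "\<And>v. v \<in> V \<Longrightarrow> card (E `` {v} \<inter> V) \<le> 1"
  shows "\<exists>i j. num_patterns E V = 2 ^ i * 6 ^ j \<and> card V = i + 2 * j \<and> (i = 0 \<longleftrightarrow> matched E V)"
  using assms
proof (induction "card V" arbitrary: V rule: less_induct)
  case less
  note fin = less.prems(1) and deg = less.prems(2)
  show ?case
  proof (cases "V = {}")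
    case True
    have "num_patterns E {} = 2 ^ 0 * 6 ^ 0 \<and> card ({}::'a set) = 0 + 2 * 0 \<and> (0 = (0::nat) \<longleftrightarrow> matched E {})"
      using num_patterns_empty[of E] by (simp add: matched_def)
    then show ?thesis unfolding True by blast
  next
    case False
    then obtain v where v: "v \<in> V" by blast
    have IH: "\<exists>i j. num_patterns E (V - X) = 2 ^ i * 6 ^ j \<and> card (V - X) = i + 2 * j \<and> (i = 0 \<longleftrightarrow> matched E (V - X))"
      if "v \<in> X" for X
    proof (rule less.hyps)
      show "card (V - X) < card V"
        by (rule psubset_card_mono) (use fin v that in auto)
      show "card (E `` {u} \<inter> (V - X)) \<le> 1" if "u \<in> V - X" for u
        using deg[of u] that card_mono[of "E `` {u} \<inter> V" "E `` {u} \<inter> (V - X)"] fin by fastforce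
    qed (use fin in auto)
    show ?thesis
    proof (cases "E `` {v} \<inter> V = {}")
      case True
      obtain i j where "num_patterns E (V - {v}) = 2 ^ i * 6 ^ j" "card (V - {v}) = i + 2 * j"
        using IH[of "{v}"] by auto
      then have "num_patterns E V = 2 ^ Suc i * 6 ^ j" "card V = Suc i + 2 * j"
        using num_patterns_isolated[OF sym_E irrefl_E fin v True] fin v card_Suc_Diff1[OF fin v] by auto
      moreover have "\<not> matched E V" using v True unfolding matched_def by force
      ultimately show ?thesis by blast
    next
      case False
      obtain w where w: "w \<in> V" "v \<noteq> w" "E `` {v} \<inter> V = {w}" "E `` {w} \<inter> V = {v}"
        using max_degree_1_partner[OF sym_E irrefl_E fin deg v False] by blast
      have cV: "card (V - {v, w}) + 2 = card V"
        using v w fin card_mono[of V "{v, w}"] by (simp add: card_Diff_subset)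
      have away: "E `` {u} \<inter> (V - {v, w}) = E `` {u} \<inter> V" if "u \<in> V - {v, w}" for u
      proof -
        have "x \<notin> {v, w}" if "(u, x) \<in> E" for x
        proof
          assume "x \<in> {v, w}"
          then have "u \<in> E `` {v} \<inter> V \<or> u \<in> E `` {w} \<inter> V"
            using that \<open>u \<in> V - {v, w}\<close> symD[OF sym_E] by blast
          then show False using \<open>u \<in> V - {v, w}\<close> unfolding w(3,4) by auto
        qed
        then show ?thesis by blast
      qed
      have "\<exists>x. E `` {u} \<inter> V = {x}" if "u \<in> {v, w}" for u
        using that w(3,4) by (cases "u = v") simp_all
      then have "(\<forall>u\<in>V - {v, w}. \<exists>x. E `` {u} \<inter> V = {x}) \<longleftrightarrow> (\<forall>u\<in>V. \<exists>x. E `` {u} \<inter> V = {x})"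
        by blast
      then have "matched E (V - {v, w}) \<longleftrightarrow> matched E V"
        using away unfolding matched_def by simp
      moreover obtain i j where "num_patterns E (V - {v, w}) = 2 ^ i * 6 ^ j" "card (V - {v, w}) = i + 2 * j"
          "i = 0 \<longleftrightarrow> matched E (V - {v, w})"
        using IH[of "{v, w}"] by auto
      ultimately have "num_patterns E V = 2 ^ i * 6 ^ Suc j \<and> card V = i + 2 * Suc j \<and> (i = 0 \<longleftrightarrow> matched E V)"
        using num_patterns_edge[OF sym_E irrefl_E fin v w(3,4)] cV by simp
      then show ?thesis by blast
    qed
  qed
qed

lemma num_patterns_high_degree_le:
  assumes fin: "finite V" and v: "v \<in> V" "2 \<le> card (E `` {v} \<inter> V)"
  shows "real (num_patterns E V) \<le> 7 / 3 * sqrt 6 ^ (card V - 1)"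
proof -
  have b: "real (card (sign_patterns E (V - {v}) (E `` {v}) {})) \<le> pattern_weight (V - {v}) (E `` {v})"
    using card_sign_patterns_le[OF sym_E irrefl_E, of "V - {v}" "E `` {v}" "{}"] fin by simp
  have "real (card (patterns_meeting E (V - {v}) (E `` {v}))) \<le> num_patterns E (V - {v})"
    using card_meeting_patterns_le[of "V - {v}" E "E `` {v}"] fin by simp
  also have "\<dots> \<le> sqrt 6 ^ (card V - 1)"
    using num_patterns_le_sqrt6_power[of "V - {v}"] fin v by simp
  finally show ?thesis using num_patterns_high_degree(1)[OF sym_E irrefl_E fin v b] by simp
qed

lemma num_patterns_eq_sqrt6_power_iff:
  assumes fin: "finite V"
  shows "real (num_patterns E V) = sqrt 6 ^ card V \<longleftrightarrow> matched E V"
proof (cases "\<exists>v\<in>V. 2 \<le> card (E `` {v} \<inter> V)")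
  case True
  then obtain v where v: "v \<in> V" "2 \<le> card (E `` {v} \<inter> V)" by blast
  have "real (num_patterns E V) \<le> 7 / 3 * sqrt 6 ^ (card V - 1)"
    by (rule num_patterns_high_degree_le[OF fin v])
  also have "\<dots> < sqrt 6 * sqrt 6 ^ (card V - 1)"
    using sqrt6_gt by (intro mult_strict_right_mono) auto
  also have "\<dots> = sqrt 6 ^ card V"
    using v fin by (cases "card V") auto
  finally have "real (num_patterns E V) \<noteq> sqrt 6 ^ card V" by simp
  moreover have "\<not> matched E V" using matched_max_degree_1[OF _ v(1)] v(2) by force
  ultimately show ?thesis by simp
next
  case False
  then have "card (E `` {v} \<inter> V) \<le> 1" if "v \<in> V" for v using that by force
  then obtain i j where ij: "num_patterns E V = 2 ^ i * 6 ^ j" "card V = i + 2 * j" "i = 0 \<longleftrightarrow> matched E V"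
    using num_patterns_max_degree_1[OF fin] by blast
  have "2 ^ i < sqrt 6 ^ i" if "i \<noteq> 0"
    using that sqrt6_gt by (intro power_strict_mono) auto
  then have "2 ^ i * 6 ^ j = sqrt 6 ^ i * 6 ^ j \<longleftrightarrow> i = 0" by (cases "i = 0") auto
  then show ?thesis
    unfolding ij(1,2) by (simp add: power_add sqrt6_power_even ij(3))
qed

text \<open>
  Without a vertex of degree at least \<open>2\<close>, parity leaves an isolated vertex, whose factor \<open>2\<close> is
  below \<open>7 / 3\<close>.
\<close>
lemma num_patterns_odd_le:
  assumes fin: "finite V" and odd: "odd (card V)"
  shows "real (num_patterns E V) \<le> 7 / 3 * sqrt 6 ^ (card V - 1)"
    and "real (num_patterns E V) = 7 / 3 * sqrt 6 ^ (card V - 1) \<Longrightarrow> \<exists>v\<in>V. 2 \<le> card (E `` {v} \<inter> V)"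
proof -
  have main: "real (num_patterns E V) < 7 / 3 * sqrt 6 ^ (card V - 1)"
    if no_high: "\<not> (\<exists>v\<in>V. 2 \<le> card (E `` {v} \<inter> V))"
  proof -
    have "card (E `` {v} \<inter> V) \<le> 1" if "v \<in> V" for v
      using no_high that by force
    then obtain i j where ij: "num_patterns E V = 2 ^ i * 6 ^ j" "card V = i + 2 * j"
      using num_patterns_max_degree_1[OF fin] by blast
    then obtain k where k: "i = Suc k" using odd by (cases i) auto
    have "real (num_patterns E V) = 2 * (2 ^ k * 6 ^ j)" unfolding ij k by simp
    also have "\<dots> \<le> 2 * (sqrt 6 ^ k * 6 ^ j)"
      using sqrt6_gt by (intro mult_left_mono mult_right_mono power_mono) auto
    also have "\<dots> < 7 / 3 * (sqrt 6 ^ k * 6 ^ j)" by simp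
    finally show ?thesis unfolding ij k by (simp add: power_add sqrt6_power_even)
  qed
  show "real (num_patterns E V) \<le> 7 / 3 * sqrt 6 ^ (card V - 1)"
    using main num_patterns_high_degree_le[OF fin] by fastforce
  show "real (num_patterns E V) = 7 / 3 * sqrt 6 ^ (card V - 1) \<Longrightarrow> \<exists>v\<in>V. 2 \<le> card (E `` {v} \<inter> V)"
    using main by fastforce
qed

text \<open>
  Equality at a vertex \<open>v\<close> of degree at least \<open>2\<close> makes every estimate sharp: \<open>V - {v}\<close> is
  perfectly matched, \<open>v\<close> has exactly two neighbours, and each pattern on \<open>V - {v}\<close> is nonzero on
  one of them.
\<close>
lemma num_patterns_odd_eq_iff:
  assumes fin: "finite V" and odd: "odd (card V)"
  shows "real (num_patterns E V) = 7 / 3 * sqrt 6 ^ (card V - 1) \<longleftrightarrow> matched_with_triangle E V"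
proof
  assume eq: "real (num_patterns E V) = 7 / 3 * sqrt 6 ^ (card V - 1)"
  then obtain v where v: "v \<in> V" "2 \<le> card (E `` {v} \<inter> V)"
    using num_patterns_odd_le(2)[OF fin odd] by blast
  let ?W = "V - {v}"
  have finW: "finite ?W" and cW: "card ?W = card V - 1" using fin v by auto
  have b: "real (card (sign_patterns E ?W (E `` {v}) {})) \<le> pattern_weight ?W (E `` {v})"
    using card_sign_patterns_le[OF sym_E irrefl_E finW, of "E `` {v}" "{}"] by simp
  note N = num_patterns_high_degree[OF sym_E irrefl_E fin v b]
  have meet: "card (patterns_meeting E ?W (E `` {v})) \<le> num_patterns E ?W"
    by (rule card_meeting_patterns_le[OF finW])
  have W: "real (num_patterns E ?W) \<le> sqrt 6 ^ (card V - 1)"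
    using num_patterns_le_sqrt6_power[OF finW] cW by simp
  have "real (num_patterns E ?W) = sqrt 6 ^ card ?W"
    using N(1) meet W eq unfolding cW by linarith
  then have mW: "matched E ?W" using num_patterns_eq_sqrt6_power_iff[OF finW] by simp
  have "card (patterns_meeting E ?W (E `` {v})) = num_patterns E ?W"
    using N(1) meet W eq by linarith
  then have all_meet: "patterns_meeting E ?W (E `` {v}) = sign_patterns E ?W {} {}"
    by (intro card_subset_eq finite_sign_patterns finW) auto
  have "card (E `` {v} \<inter> V) = 2"
    using N(2) meet W eq v(2) by fastforce
  then obtain a b where ab: "E `` {v} \<inter> V = {a, b}" "a \<noteq> b"
    by (auto simp: card_2_iff)
  have "a \<in> E `` {v} \<inter> V" "b \<in> E `` {v} \<inter> V" unfolding ab by auto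
  then have va: "a \<in> V" "(v, a) \<in> E" "(a, v) \<in> E" "b \<in> V" "(v, b) \<in> E" "(b, v) \<in> E"
    using symD[OF sym_E] by auto
  then have ne: "v \<noteq> a" "v \<noteq> b" using irrefl_E by (auto simp: irrefl_def)
  obtain a' b' where a': "E `` {a} \<inter> ?W = {a'}" and b': "E `` {b} \<inter> ?W = {b'}"
  proof -
    have "a \<in> ?W" "b \<in> ?W" using va ne by auto
    then show thesis using mW that unfolding matched_def by meson
  qed
  have "a' \<in> E `` {a} \<inter> ?W" "b' \<in> E `` {b} \<inter> ?W" unfolding a' b' by auto
  then have a'b': "(a, a') \<in> E" "a' \<in> ?W" "(b, b') \<in> E" "b' \<in> ?W" by auto
  have "(a, b) \<in> E"
  proof (rule ccontr)
    assume nab: "(a, b) \<notin> E"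
    \<comment> \<open>The partners of \<open>a\<close> and \<open>b\<close> are then among the other vertices, so \<open>a\<close> and \<open>b\<close> can
      both be zero while all other vertices are positive.\<close>
    have "(?W - {a, b}, {}) \<in> sign_patterns E ?W {} {}"
    proof (rule sign_patternsI)
      fix x assume "x \<in> ?W" "x \<notin> ?W - {a, b}"
      moreover have "a' \<in> ?W - {a, b}" "b' \<in> ?W - {a, b}"
        using a'b' nab symD[OF sym_E] irrefl_E by (auto simp: irrefl_def)
      ultimately show "\<exists>u\<in>?W - {a, b} \<union> {}. (x, u) \<in> E" using a'b' by blast
    qed auto
    then have "E `` {v} \<inter> (?W - {a, b}) \<noteq> {}" using all_meet by blast
    then show False using ab by blast
  qed
  then have ba: "(b, a) \<in> E" using symD[OF sym_E] by blast
  have "b \<in> E `` {a} \<inter> ?W" "a \<in> E `` {b} \<inter> ?W" using \<open>(a, b) \<in> E\<close> ba va(1,4) ne by blast+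
  then have "a' = b" "b' = a" unfolding a' b' by auto
  have nb: "E `` {a} \<inter> V = {v, b}" "E `` {b} \<inter> V = {v, a}"
  proof -
    have "E `` {a} \<inter> V = insert v (E `` {a} \<inter> ?W)" "E `` {b} \<inter> V = insert v (E `` {b} \<inter> ?W)"
      using va v(1) by blast+
    then show "E `` {a} \<inter> V = {v, b}" "E `` {b} \<inter> V = {v, a}"
      unfolding a' b' \<open>a' = b\<close> \<open>b' = a\<close> by auto
  qed
  let ?T = "{v, a, b}"
  have "matched E (V - ?T)" unfolding matched_def
  proof
    fix x assume x: "x \<in> V - ?T"
    then obtain y where y: "E `` {x} \<inter> ?W = {y}" using mW unfolding matched_def by blast
    have "z \<notin> {a, b}" if "(x, z) \<in> E" for z
    proof
      assume "z \<in> {a, b}"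
      then have "x \<in> E `` {a} \<inter> V \<or> x \<in> E `` {b} \<inter> V" using that symD[OF sym_E] x by blast
      then show False using x unfolding nb by auto
    qed
    then have "E `` {x} \<inter> (V - ?T) = E `` {x} \<inter> ?W" by blast
    then show "\<exists>y. E `` {x} \<inter> (V - ?T) = {y}" using y by simp
  qed
  moreover have "card ?T = 3" using ne ab by simp
  moreover have "\<forall>x\<in>?T. E `` {x} \<inter> V = ?T - {x}"
  proof
    fix x assume "x \<in> ?T"
    then consider "x = v" | "x = a" | "x = b" by blast
    then show "E `` {x} \<inter> V = ?T - {x}"
      by cases (simp_all only: ab(1) nb, use ab(2) ne in auto)
  qed
  moreover have "?T \<subseteq> V" using va v by auto
  ultimately show "matched_with_triangle E V" unfolding matched_with_triangle_def by blast
next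
  assume "matched_with_triangle E V"
  then obtain T where T: "T \<subseteq> V" "card T = 3" "\<And>v. v \<in> T \<Longrightarrow> E `` {v} \<inter> V = T - {v}" "matched E (V - T)"
    unfolding matched_with_triangle_def by blast
  have finT: "finite T" using fin T(1) finite_subset by blast
  have cut: "(u, w) \<in> E \<longleftrightarrow> w \<in> T \<and> w \<noteq> u" if "u \<in> T" "w \<in> V" for u w
  proof -
    have "(u, w) \<in> E \<longleftrightarrow> w \<in> E `` {u} \<inter> V" using that by simp
    then show ?thesis unfolding T(3)[OF that(1)] by auto
  qed
  have "num_patterns E T + 2 = 2 ^ (card T + 1)"
    using T(1,2) finT cut by (intro num_patterns_complete[OF sym_E irrefl_E]) auto
  then have NT: "num_patterns E T = 14" using T(2) by simp
  have "num_patterns E (T \<union> (V - T)) = num_patterns E T * num_patterns E (V - T)"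
  proof (rule num_patterns_Un)
    show "E \<inter> T \<times> (V - T) = {}" using cut by blast
  qed (use fin finT sym_E in auto)
  moreover have "T \<union> (V - T) = V" using T(1) by blast
  moreover have "real (num_patterns E (V - T)) = sqrt 6 ^ card (V - T)"
    using num_patterns_eq_sqrt6_power_iff[of "V - T"] T(4) fin by simp
  ultimately have "real (num_patterns E V) = 14 * sqrt 6 ^ card (V - T)" using NT by simp
  moreover have "card (V - T) + 2 = card V - 1"
    using T(1,2) fin finT card_mono[OF fin T(1)] by (simp add: card_Diff_subset)
  then have "sqrt 6 ^ (card V - 1) = 6 * sqrt 6 ^ card (V - T)"
    by (rule sqrt6_power_add_2)
  ultimately show "real (num_patterns E V) = 7 / 3 * sqrt 6 ^ (card V - 1)" by simp
qed

end

section \<open>Facets of the convex hull of a symmetric set\<close>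
lemma aff_dim_section_off_origin:
  fixes F :: "'a::euclidean_space set"
  assumes "F \<subseteq> {x. a \<bullet> x = 1}"
  shows "aff_dim F = int (dim F) - 1"
proof -
  have "affine hull F \<subseteq> {x. a \<bullet> x = 1}"
    using assms by (intro hull_minimal affine_hyperplane)
  then have "0 \<notin> affine hull F" by auto
  then have "aff_dim (insert 0 F) = aff_dim F + 1" by (simp add: aff_dim_insert)
  moreover have "aff_dim (insert 0 F) = int (dim F)"
    by (simp add: aff_dim_zero hull_inc dim_insert span_zero)
  ultimately show ?thesis by simp
qed

lemma convex_hull_subset_span: "convex hull S \<subseteq> span S"
  by (rule hull_minimal) (auto simp: span_superset subspace_imp_convex)

lemma zero_in_symmetric_hull:
  assumes "S \<noteq> {}" "\<And>x. x \<in> S \<Longrightarrow> - x \<in> S"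
  shows "0 \<in> convex hull S"
proof -
  obtain x where "x \<in> S" using assms(1) by blast
  then have "x \<in> convex hull S" "- x \<in> convex hull S" using assms(2) by (auto intro: hull_inc)
  then have "(1/2) *\<^sub>R x + (1/2) *\<^sub>R (- x) \<in> convex hull S"
    by (intro convexD[OF convex_convex_hull]) auto
  then show ?thesis by simp
qed

text \<open>
  Since the hull contains the origin, its dimension is that of its span, whereas a section by a
  hyperplane \<open>a \<bullet> x = 1\<close> has one dimension less than its span. Hence a supporting
  hyperplane of this form cuts out a facet if the points of \<open>S\<close> on it span all of \<open>S\<close>.
\<close>
lemma facet_of_symmetric_hullI:
  fixes S :: "'a::euclidean_space set"
  assumes sym: "\<And>x. x \<in> S \<Longrightarrow> - x \<in> S"
    and le: "\<And>x. x \<in> S \<Longrightarrow> a \<bullet> x \<le> 1"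
    and nonempty: "{x \<in> S. a \<bullet> x = 1} \<noteq> {}"
    and tight: "S \<subseteq> span {x \<in> S. a \<bullet> x = 1}"
  shows "(convex hull S \<inter> {x. a \<bullet> x = 1}) facet_of (convex hull S)"
proof -
  let ?P = "convex hull S" and ?T = "{x \<in> S. a \<bullet> x = 1}"
  let ?F = "?P \<inter> {x. a \<bullet> x = 1}"
  have "?P \<subseteq> {x. a \<bullet> x \<le> 1}"
    using le by (intro hull_minimal convex_halfspace_le) auto
  then have face: "?F face_of ?P" by (intro face_of_Int_supporting_hyperplane_le) auto
  have TF: "?T \<subseteq> ?F" by (auto intro: hull_inc)
  have "?P \<subseteq> span ?T"
    using convex_hull_subset_span[of S] tight span_minimal[OF tight subspace_span] by blast
  then have "dim ?P \<le> dim ?F"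
    using dim_subset[of ?P "span ?T"] dim_subset[OF TF] by simp
  then have "dim ?F = dim ?P" using dim_subset[of ?F ?P] by simp
  moreover have "aff_dim ?P = int (dim ?P)"
    using nonempty by (intro aff_dim_zero[OF hull_inc] zero_in_symmetric_hull sym) auto
  ultimately have "aff_dim ?F = aff_dim ?P - 1"
    using aff_dim_section_off_origin[of ?F a] by simp
  then show ?thesis using face TF nonempty unfolding facet_of_def by blast
qed

text \<open>
  The supporting hyperplane of a facet cannot pass through the origin: by symmetry the hull would
  lie inside it. So it can be scaled to \<open>a \<bullet> x = 1\<close>. The facet is the hull of the points of \<open>S\<close>
  on it, and a comparison of dimensions shows that these span all of \<open>S\<close>.
\<close>
lemma facet_of_symmetric_hullE:
  fixes S :: "'a::euclidean_space set"
  assumes fin: "finite S" and sym: "\<And>x. x \<in> S \<Longrightarrow> - x \<in> S"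
    and facet: "F facet_of (convex hull S)"
  obtains a where "\<And>x. x \<in> S \<Longrightarrow> a \<bullet> x \<le> 1" "F = convex hull S \<inter> {x. a \<bullet> x = 1}"
    "S \<subseteq> span {x \<in> S. a \<bullet> x = 1}"
proof -
  let ?P = "convex hull S"
  have face: "F face_of ?P" and F: "F \<noteq> {}" "aff_dim F = aff_dim ?P - 1"
    using facet by (auto simp: facet_of_def)
  have "F exposed_face_of ?P"
    using exposed_face_of_polyhedron[OF polytope_imp_polyhedron[OF polytope_convex_hull[OF fin]]] face
    by simp
  then obtain c b where c: "?P \<subseteq> {x. c \<bullet> x \<le> b}" "F = ?P \<inter> {x. c \<bullet> x = b}"
    unfolding exposed_face_of_def by blast
  have "S \<noteq> {}" using F(1) face_of_imp_subset[OF face] by auto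
  then have zero: "0 \<in> ?P" by (rule zero_in_symmetric_hull[OF _ sym])
  then have "0 \<le> b" using c(1) by auto
  moreover have "b \<noteq> 0"
  proof
    assume "b = 0"
    have "c \<bullet> x = 0" if "x \<in> S" for x
    proof -
      have "x \<in> ?P" "- x \<in> ?P" using that sym by (auto intro: hull_inc)
      then have "c \<bullet> x \<le> 0" "c \<bullet> (- x) \<le> 0" using c(1) \<open>b = 0\<close> by blast+
      then show ?thesis by simp
    qed
    then have "?P \<subseteq> {x. c \<bullet> x = 0}" by (intro hull_minimal convex_hyperplane) auto
    then have "F = ?P" using c(2) \<open>b = 0\<close> by auto
    then show False using F(2) by simp
  qed
  ultimately have b: "0 < b" by simp
  define a where "a = (1 / b) *\<^sub>R c"
  have a: "a \<bullet> x = (c \<bullet> x) / b" for x by (simp add: a_def)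
  have le: "a \<bullet> x \<le> 1" if "x \<in> S" for x
    using c(1) hull_inc[OF that, of convex] b by (auto simp: a)
  have Fa: "F = ?P \<inter> {x. a \<bullet> x = 1}" using c(2) b by (auto simp: a)
  let ?T = "{x \<in> S. a \<bullet> x = 1}"
  obtain S' where S': "S' \<subseteq> S" "F = convex hull S'"
    using face_of_convex_hull_subset[OF finite_imp_compact[OF fin] face] by blast
  have "S' \<subseteq> F" using S'(2) by (simp add: hull_subset)
  then have "S' \<subseteq> ?T" using S'(1) Fa by blast
  then have FT: "F \<subseteq> span ?T"
    using convex_hull_subset_span[of S'] S'(2) span_mono by blast
  have "aff_dim F = int (dim F) - 1"
    by (rule aff_dim_section_off_origin[of F a]) (use Fa in auto)
  moreover have "aff_dim ?P = int (dim ?P)" by (rule aff_dim_zero[OF hull_inc[OF zero]])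
  ultimately have "dim F = dim ?P" using F(2) by simp
  then have "dim S \<le> dim ?T"
    using dim_subset[OF FT] dim_subset[OF hull_subset[of S convex]] by simp
  then have "span ?T = span S"
    by (intro subspace_dim_equal span_mono) auto
  then have "S \<subseteq> span ?T" using span_superset by blast
  then show thesis using that le Fa by blast
qed

section \<open>Facets of the symmetric edge polytope of a suspension\<close>
definition pattern_vector :: "'v::finite set \<times> 'v set \<Rightarrow> real ^ 'v option" where
  "pattern_vector f = (\<chi> i. case i of None \<Rightarrow> 0 |
     Some v \<Rightarrow> if v \<in> fst f then 1 else if v \<in> snd f then - 1 else 0)"

lemma pattern_vector_levels:
  assumes "f \<in> sign_patterns E V {} {}"
  shows "fst f = {v. pattern_vector f $ Some v = 1}" "snd f = {v. pattern_vector f $ Some v = - 1}"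
proof -
  have "fst f \<inter> snd f = {}" using assms sign_patternsD(3)[of "fst f" "snd f"] by simp
  then have "v \<notin> snd f" if "v \<in> fst f" for v using that by blast
  then show "fst f = {v. pattern_vector f $ Some v = 1}" "snd f = {v. pattern_vector f $ Some v = - 1}"
    by (auto simp: pattern_vector_def)
qed

definition edge_vectors :: "'v::finite pair_pre_digraph \<Rightarrow> (real ^ 'v) set" where
  "edge_vectors G = (\<lambda>(i, j). axis i 1 - axis j 1) ` parcs G"

lemma inner_edge_vector: "a \<bullet> (axis i 1 - axis j 1) = a $ i - a $ j" for a :: "real ^ 'v::finite"
  by (simp add: inner_diff_right inner_axis)

lemma symmetric_edge_polytope_eq:
  assumes "sym (parcs G)"
  shows "symmetric_edge_polytope G = convex hull (edge_vectors G)"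
proof -
  have "(\<Union>(i, j)\<in>parcs G. {axis i 1 - axis j 1, - (axis i 1 - axis j (1::real))}) = edge_vectors G"
    using assms unfolding edge_vectors_def by (force dest: symD simp: image_iff)
  then show ?thesis unfolding symmetric_edge_polytope_def by simp
qed

lemma uminus_edge_vectors:
  assumes "sym (parcs G)" "x \<in> edge_vectors G"
  shows "- x \<in> edge_vectors G"
  using assms unfolding edge_vectors_def by (force dest: symD simp: image_iff)

lemma suspension_arcs:
  "(Some u, Some v) \<in> parcs (suspension G) \<longleftrightarrow> (u, v) \<in> parcs G"
  "(Some u, None) \<in> parcs (suspension G) \<longleftrightarrow> u \<in> pverts G"
  "(None, Some u) \<in> parcs (suspension G) \<longleftrightarrow> u \<in> pverts G"
  "(None, None) \<notin> parcs (suspension G)"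
  by (auto simp: suspension_def)

lemma sym_suspension: "sym (parcs G) \<Longrightarrow> sym (parcs (suspension G))"
  by (auto simp: suspension_def sym_def)

definition pattern_facet :: "'v::finite pair_pre_digraph \<Rightarrow> 'v set \<times> 'v set \<Rightarrow> (real ^ 'v option) set" where
  "pattern_facet G f = symmetric_edge_polytope (suspension G) \<inter> {x. pattern_vector f \<bullet> x = 1}"

context
  fixes G :: "'v::finite pair_pre_digraph"
  assumes sym_G: "sym (parcs G)" and verts_G: "pverts G = UNIV"
begin

lemma edge_vectors_cone: "axis (Some v) 1 - axis None 1 \<in> edge_vectors (suspension G)"
  using suspension_arcs(2)[of v G] verts_G unfolding edge_vectors_def by force

lemma edge_vectors_subset_span:
  assumes cone: "\<And>v. axis (Some v) 1 - axis None 1 \<in> span T"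
  shows "edge_vectors (suspension G) \<subseteq> span T"
proof -
  have star: "axis i 1 - axis None 1 \<in> span T" for i
    using cone by (cases i) (auto simp: span_zero)
  have "axis i 1 - axis j 1 \<in> span T" for i j
    using span_diff[OF star[of i] star[of j]] by simp
  then show ?thesis unfolding edge_vectors_def by auto
qed

text \<open>
  The tight edges contain a spanning tree: a nonzero vertex is joined to the apex by a tight edge,
  a zero vertex to a nonzero neighbour.
\<close>
lemma pattern_vector_tight_span:
  assumes f: "f \<in> sign_patterns (parcs G) UNIV {} {}"
  shows "edge_vectors (suspension G) \<subseteq> span {x \<in> edge_vectors (suspension G). pattern_vector f \<bullet> x = 1}" (is "_ \<subseteq> span ?T")
proof (rule edge_vectors_subset_span)
  obtain A B where AB: "f = (A, B)" by (cases f)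
  note D = sign_patternsD[OF f[unfolded AB]]
  have tight: "axis i 1 - axis j 1 \<in> span ?T"
    if "(i, j) \<in> parcs (suspension G)" "pattern_vector f $ i - pattern_vector f $ j = 1" for i j
    using that unfolding edge_vectors_def
    by (intro span_base) (force simp: inner_edge_vector)
  have nonzero: "axis (Some v) 1 - axis None 1 \<in> span ?T" if "v \<in> A \<union> B" for v
  proof (cases "v \<in> A")
    case True
    then show ?thesis
      by (intro tight) (auto simp: suspension_arcs verts_G pattern_vector_def AB)
  next
    case False
    then have "axis None 1 - axis (Some v) 1 \<in> span ?T"
      using that by (intro tight) (auto simp: suspension_arcs verts_G pattern_vector_def AB)
    then show ?thesis using span_neg by fastforce
  qed
  fix v
  show "axis (Some v) 1 - axis None 1 \<in> span ?T"
  proof (cases "v \<in> A \<union> B")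
    case True
    then show ?thesis by (rule nonzero)
  next
    case False
    then obtain u where u: "u \<in> A \<union> B" "(v, u) \<in> parcs G" using D(5)[of v] by blast
    have uv: "(u, v) \<in> parcs G" using u symD[OF sym_G] by blast
    have "axis (Some v) 1 - axis (Some u) 1 \<in> span ?T"
    proof (cases "u \<in> A")
      case True
      then have "axis (Some u) 1 - axis (Some v) 1 \<in> span ?T"
        using False uv by (intro tight) (auto simp: suspension_arcs pattern_vector_def AB)
      then show ?thesis using span_neg by fastforce
    next
      case u_in_B: False
      then show ?thesis
        using False u by (intro tight) (auto simp: suspension_arcs pattern_vector_def AB)
    qed
    then show ?thesis using span_add[OF _ nonzero[OF u(1)]] by fastforce
  qed
qed

lemma pattern_vector_le_1:
  assumes f: "f \<in> sign_patterns (parcs G) UNIV {} {}" and x: "x \<in> edge_vectors (suspension G)"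
  shows "pattern_vector f \<bullet> x \<le> 1"
proof -
  obtain A B where AB: "f = (A, B)" by (cases f)
  note D = sign_patternsD[OF f[unfolded AB]]
  obtain i j where ij: "(i, j) \<in> parcs (suspension G)" "x = axis i 1 - axis j 1"
    using x unfolding edge_vectors_def by auto
  have "pattern_vector f $ i - pattern_vector f $ j \<le> 1"
  proof (cases i; cases j)
    fix u v assume "i = Some u" "j = Some v"
    then show ?thesis using ij(1) D(4)[of u v] by (auto simp: suspension_arcs pattern_vector_def AB)
  qed (auto simp: pattern_vector_def)
  then show ?thesis unfolding ij(2) inner_edge_vector .
qed

lemma suspension_polytope_eq: "symmetric_edge_polytope (suspension G) = convex hull (edge_vectors (suspension G))"
  by (rule symmetric_edge_polytope_eq[OF sym_suspension[OF sym_G]])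

lemmas uminus_suspension_vectors = uminus_edge_vectors[OF sym_suspension[OF sym_G]]

lemma pattern_facet_facet_of:
  assumes f: "f \<in> sign_patterns (parcs G) UNIV {} {}"
  shows "pattern_facet G f facet_of (symmetric_edge_polytope (suspension G))"
  unfolding pattern_facet_def suspension_polytope_eq
proof (rule facet_of_symmetric_hullI)
  show "{x \<in> edge_vectors (suspension G). pattern_vector f \<bullet> x = 1} \<noteq> {}" (is "?T \<noteq> {}")
  proof
    assume "?T = {}"
    then have "axis (Some v) 1 - axis None (1::real) \<in> {0}" for v :: 'v
      using pattern_vector_tight_span[OF f] edge_vectors_cone by (metis span_empty subsetD)
    then have "(axis (Some v) 1 - axis None (1::real)) $ None = 0" for v :: 'v by simp
    then show False by (simp add: axis_def)
  qed
qed (use pattern_vector_tight_span[OF f] pattern_vector_le_1[OF f] uminus_suspension_vectors in auto)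

text \<open>
  Functionals that agree on a set spanning the edge vectors have the same differences to the apex,
  as each \<open>axis (Some v) 1 - axis None 1\<close> is an edge vector.
\<close>
lemma inner_span_eq:
  assumes "edge_vectors (suspension G) \<subseteq> span T" "\<And>x. x \<in> T \<Longrightarrow> a \<bullet> x = b \<bullet> x"
  shows "a $ Some v - a $ None = b $ Some v - b $ None"
proof -
  have "axis (Some v) 1 - axis None 1 \<in> span T" using assms(1) edge_vectors_cone by blast
  moreover have "orthogonal (a - b) y" if "y \<in> T" for y
    using assms(2)[OF that] by (simp add: orthogonal_def inner_diff_left)
  ultimately have "orthogonal (a - b) (axis (Some v) 1 - axis None 1)" by (rule orthogonal_to_span)
  then show ?thesis by (simp add: orthogonal_def inner_diff_left inner_edge_vector)
qed

lemma inj_on_pattern_facet: "inj_on (pattern_facet G) (sign_patterns (parcs G) UNIV {} {})"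
proof (rule inj_onI)
  fix f g assume f: "f \<in> sign_patterns (parcs G) UNIV {} {}" and g: "g \<in> sign_patterns (parcs G) UNIV {} {}"
    and eq: "pattern_facet G f = pattern_facet G g"
  have "pattern_vector f \<bullet> x = pattern_vector g \<bullet> x" if "x \<in> {x \<in> edge_vectors (suspension G). pattern_vector f \<bullet> x = 1}" for x
  proof -
    have "x \<in> pattern_facet G f" using that unfolding pattern_facet_def suspension_polytope_eq by (auto intro: hull_inc)
    then show ?thesis using that unfolding eq unfolding pattern_facet_def by auto
  qed
  from inner_span_eq[OF pattern_vector_tight_span[OF f] this]
  have "pattern_vector f $ Some v = pattern_vector g $ Some v" for v by (simp add: pattern_vector_def)
  then have "fst f = fst g" "snd f = snd g"
    using pattern_vector_levels[OF f] pattern_vector_levels[OF g] by auto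
  then show "f = g" by (simp add: prod_eq_iff)
qed

text \<open>
  A union of components of the graph of tight edges that avoids the apex has an
  indicator vector orthogonal to all tight edges, hence to everything they span, so it is
  empty. Thus the tight edges of a facet connect all vertices to the apex.
\<close>
lemma tight_closed_set_empty:
  assumes tight: "edge_vectors (suspension G) \<subseteq> span {x \<in> edge_vectors (suspension G). a \<bullet> x = 1}"
    and closed: "\<And>i j. (i, j) \<in> parcs (suspension G) \<Longrightarrow> a $ i - a $ j = 1 \<Longrightarrow> i \<in> X \<longleftrightarrow> j \<in> X"
    and None: "None \<notin> X"
  shows "X = {}"
proof -
  define y :: "real ^ 'v option" where "y = (\<chi> i. if i \<in> X then 1 else 0)"
  have "y \<bullet> x = 0 \<bullet> x" if x: "x \<in> {x \<in> edge_vectors (suspension G). a \<bullet> x = 1}" for x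
  proof -
    obtain i j where ij: "(i, j) \<in> parcs (suspension G)" "x = axis i 1 - axis j 1"
      using x unfolding edge_vectors_def by auto
    have "a $ i - a $ j = 1" using x by (simp add: ij(2) inner_edge_vector)
    then have "y $ i = y $ j" using closed[OF ij(1)] by (simp add: y_def)
    then show ?thesis unfolding ij(2) inner_edge_vector by simp
  qed
  from inner_span_eq[OF tight this] have y0: "y $ Some v = 0" for v using None by (simp add: y_def)
  have Some: "Some v \<notin> X" for v using y0[of v] by (auto simp: y_def split: if_splits)
  have "i \<notin> X" for i using None Some by (cases i) auto
  then show ?thesis by blast
qed

text \<open>
  Tight edges change the functional by \<open>1\<close>, so no component of the tight graph mixes integral and
  non-integral values. As all components contain the apex, the values are integers, and the edges
  to the apex confine them to \<open>{- 1, 0, 1}\<close>. A zero vertex without nonzero neighbour would have no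
  tight edge at all and form a component by itself.
\<close>
lemma facet_is_pattern_facet:
  assumes facet: "F facet_of (symmetric_edge_polytope (suspension G))"
  shows "F \<in> pattern_facet G ` sign_patterns (parcs G) UNIV {} {}"
proof -
  have "finite (edge_vectors (suspension G))" unfolding edge_vectors_def by simp
  from facet_of_symmetric_hullE[OF this uminus_suspension_vectors facet[unfolded suspension_polytope_eq]]
  obtain a where le: "\<And>x. x \<in> edge_vectors (suspension G) \<Longrightarrow> a \<bullet> x \<le> 1" and F: "F = convex hull (edge_vectors (suspension G)) \<inter> {x. a \<bullet> x = 1}"
    and tight: "edge_vectors (suspension G) \<subseteq> span {x \<in> edge_vectors (suspension G). a \<bullet> x = 1}" by blast
  define h where "h i = a $ i - a $ None" for i
  have arc_le: "h i - h j \<le> 1" if "(i, j) \<in> parcs (suspension G)" for i j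
  proof -
    have "axis i 1 - axis j 1 \<in> edge_vectors (suspension G)" using that unfolding edge_vectors_def by force
    then show ?thesis using le inner_edge_vector[of a i j] by (fastforce simp: h_def)
  qed
  have closed: "X = {}" if "\<And>i j. (i, j) \<in> parcs (suspension G) \<Longrightarrow> h i - h j = 1 \<Longrightarrow> i \<in> X \<longleftrightarrow> j \<in> X"
    "None \<notin> X" for X
    using that by (intro tight_closed_set_empty[OF tight, of X]) (auto simp: h_def)
  have h0: "h None = 0" by (simp add: h_def)
  have "{i. h i \<notin> \<int>} = {}"
  proof (rule closed)
    fix i j assume "h i - h j = 1"
    then have "h i = h j + 1" by simp
    then show "i \<in> {i. h i \<notin> \<int>} \<longleftrightarrow> j \<in> {i. h i \<notin> \<int>}" by simp
  qed (simp add: h0)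
  then have int: "h i \<in> \<int>" for i by blast
  have h_range: "h (Some v) \<in> {- 1, 0, 1}" for v
  proof -
    obtain k where k: "h (Some v) = of_int k" using int Ints_cases by blast
    have "h (Some v) \<le> 1" "- h (Some v) \<le> 1"
      using arc_le[of "Some v" None] arc_le[of None "Some v"] h0 by (auto simp: suspension_arcs verts_G)
    then have "k \<le> 1" "- 1 \<le> k" unfolding k by linarith+
    then have "k \<in> {- 1, 0, 1}" by auto
    then show ?thesis unfolding k by auto
  qed
  define A where "A = {v. h (Some v) = 1}"
  define B where "B = {v. h (Some v) = - 1}"
  have pattern: "(A, B) \<in> sign_patterns (parcs G) UNIV {} {}"
  proof (rule sign_patternsI)
    show "(u, v) \<notin> parcs G" if "u \<in> A" "v \<in> B" for u v
      using arc_le[of "Some u" "Some v"] that by (auto simp: suspension_arcs A_def B_def)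
    fix v assume v: "v \<notin> A" "v \<notin> B"
    then have hv: "h (Some v) = 0" using h_range[of v] by (auto simp: A_def B_def)
    show "\<exists>u\<in>A \<union> B. (v, u) \<in> parcs G"
    proof (rule ccontr)
      assume none: "\<not> (\<exists>u\<in>A \<union> B. (v, u) \<in> parcs G)"
      have no_tight: "(Some v, j) \<in> parcs (suspension G) \<Longrightarrow> h j = 0" for j
        using none h0 h_range by (cases j) (auto simp: suspension_arcs A_def B_def)
      have "{Some v} = {}"
      proof (rule closed)
        fix i j assume ij: "(i, j) \<in> parcs (suspension G)" "h i - h j = 1"
        have "(j, i) \<in> parcs (suspension G)" using ij(1) symD[OF sym_suspension[OF sym_G]] by blast
        then have "i \<noteq> Some v" "j \<noteq> Some v" using no_tight ij hv by force+
        then show "i \<in> {Some v} \<longleftrightarrow> j \<in> {Some v}" by simp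
      qed simp
      then show False by simp
    qed
  qed (auto simp: A_def B_def)
  have vec: "pattern_vector (A, B) $ i = h i" for i
    using h_range h0 by (cases i) (auto simp: pattern_vector_def A_def B_def)
  have "edge_vectors (suspension G) \<subseteq> {x. (a - pattern_vector (A, B)) \<bullet> x = 0}"
    unfolding edge_vectors_def by (auto simp: inner_diff_left inner_edge_vector vec h_def)
  then have "convex hull (edge_vectors (suspension G)) \<subseteq> {x. (a - pattern_vector (A, B)) \<bullet> x = 0}"
    by (intro hull_minimal convex_hyperplane)
  then have "F = pattern_facet G (A, B)"
    unfolding F pattern_facet_def suspension_polytope_eq by (auto simp: inner_diff_left)
  then show ?thesis using pattern by blast
qed

lemma num_facets_suspension: "num_facets (symmetric_edge_polytope (suspension G)) = num_patterns (parcs G) UNIV"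
proof -
  have "{F. F facet_of (symmetric_edge_polytope (suspension G))} = pattern_facet G ` sign_patterns (parcs G) UNIV {} {}"
    using pattern_facet_facet_of facet_is_pattern_facet by blast
  then show ?thesis unfolding num_facets_def by (simp add: card_image[OF inj_on_pattern_facet])
qed

end

section \<open>Components of the graph and their cones\<close>
definition clique_component :: "'v pair_pre_digraph \<Rightarrow> 'v set \<Rightarrow> bool" where
  "clique_component G X \<longleftrightarrow> X \<noteq> {} \<and> (\<forall>u\<in>X. parcs G `` {u} = X - {u})"

context pair_graph
begin

lemma sym_parcs: "sym (parcs G)"
  using pair_sym_arcs by (simp add: symmetric_def)

lemma irrefl_parcs: "irrefl (parcs G)"
  using pair_no_loops by (force simp: irrefl_def)

lemma reachable_in_closed:
  assumes "u \<rightarrow>\<^sup>*\<^bsub>with_proj G\<^esub> v" "u \<in> X" "\<And>x y. x \<in> X \<Longrightarrow> (x, y) \<in> parcs G \<Longrightarrow> y \<in> X"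
  shows "v \<in> X"
  using assms(1,2) by (induction rule: reachable_induct) (use assms(3) in auto)

lemma clique_component_in_sccs_verts:
  assumes X: "clique_component G X" "X \<subseteq> pverts G"
  shows "X \<in> sccs_verts"
  unfolding in_sccs_verts_conv_reachable
proof (intro conjI ballI allI impI)
  show "X \<noteq> {}" using X by (simp add: clique_component_def)
  have nb: "(u, v) \<in> parcs G \<longleftrightarrow> v \<in> X - {u}" if "u \<in> X" for u v
    using that X(1) unfolding clique_component_def by blast
  show "u \<rightarrow>\<^sup>*\<^bsub>with_proj G\<^esub> v" if "u \<in> X" "v \<in> X" for u v
  proof (cases "u = v")
    case True
    then show ?thesis using that X(2) by auto
  next
    case False
    then have "(u, v) \<in> parcs G" using nb that by blast
    then show ?thesis by (intro reachable_adjI) auto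
  qed
  show "\<not> u \<rightarrow>\<^sup>*\<^bsub>with_proj G\<^esub> v \<or> \<not> v \<rightarrow>\<^sup>*\<^bsub>with_proj G\<^esub> u" if "u \<in> X" "v \<notin> X" for u v
    using reachable_in_closed[of u v X] that nb by blast
qed

lemma sccs_verts_closed:
  assumes "X \<in> sccs_verts" "u \<in> X" "(u, v) \<in> parcs G"
  shows "v \<in> X"
proof (rule ccontr)
  assume "v \<notin> X"
  moreover have "u \<rightarrow>\<^sup>*\<^bsub>with_proj G\<^esub> v" "v \<rightarrow>\<^sup>*\<^bsub>with_proj G\<^esub> u"
    using assms(3) symD[OF sym_parcs assms(3)] by (auto intro: reachable_adjI)
  ultimately show False using assms unfolding in_sccs_verts_conv_reachable by blast
qed

text \<open>
  A component has no edges leaving it, so completeness of the subgraph that it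
  induces is a statement about the neighbourhoods in \<open>G\<close>.
\<close>
lemma complete_component_iff:
  assumes "X \<in> sccs_verts"
  shows "complete_digraph k (with_proj G \<restriction> X) \<longleftrightarrow> card X = k \<and> clique_component G X"
proof -
  have sub: "X \<subseteq> pverts G" "X \<noteq> {}"
    using assms sccs_verts_subsets by (auto simp: in_sccs_verts_conv_reachable)
  then have fin: "finite X" using pair_finite_verts finite_subset by blast
  have eq: "with_proj G \<restriction> X = with_proj \<lparr>pverts = X, parcs = {e \<in> parcs G. fst e \<in> X \<and> snd e \<in> X}\<rparr>"
    by (simp add: induce_subgraph_def with_proj_def)
  have "{e \<in> parcs G. fst e \<in> X \<and> snd e \<in> X} = {(u, v). (u, v) \<in> X \<times> X \<and> u \<noteq> v}
      \<longleftrightarrow> (\<forall>u\<in>X. parcs G `` {u} = X - {u})" (is "?L \<longleftrightarrow> ?R")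
  proof
    assume L: ?L
    show ?R
    proof
      fix u assume u: "u \<in> X"
      have "(u, v) \<in> parcs G \<longleftrightarrow> v \<in> X - {u}" for v
      proof -
        have "(u, v) \<in> parcs G \<longleftrightarrow> (u, v) \<in> {e \<in> parcs G. fst e \<in> X \<and> snd e \<in> X}"
          using u sccs_verts_closed[OF assms u, of v] by auto
        then show ?thesis unfolding L using u by auto
      qed
      then show "parcs G `` {u} = X - {u}" by auto
    qed
  next
    assume R: ?R
    have "(u, v) \<in> parcs G \<longleftrightarrow> v \<in> X - {u}" if "u \<in> X" for u v using R that by blast
    then show ?L by auto
  qed
  then show ?thesis unfolding eq complete_digraph_pair_def clique_component_def
    using fin sub by auto
qed

lemma sccs_verts_cover: "v \<in> pverts G \<Longrightarrow> \<exists>X\<in>sccs_verts. v \<in> X"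
  using scc_of_in_sccs_verts in_scc_of_self by auto

lemma card_pverts_eq_sum: "card (pverts G) = (\<Sum>X\<in>sccs_verts. card X)"
proof -
  have "pverts G = \<Union> sccs_verts"
    using sccs_verts_cover sccs_verts_subsets by blast
  moreover have "card (\<Union> sccs_verts) = (\<Sum>X\<in>sccs_verts. card X)"
  proof (rule card_Union_disjoint)
    show "pairwise disjnt sccs_verts"
      using sccs_verts_disjoint by (auto simp: pairwise_def disjnt_def)
    show "finite X" if "X \<in> sccs_verts" for X
      using sccs_verts_subsets[OF that] pair_finite_verts finite_subset by blast
  qed
  ultimately show ?thesis by simp
qed

lemma inj_on_induce: "inj_on (\<lambda>X. with_proj G \<restriction> X) A"
  by (rule inj_onI) (metis induce_subgraph_verts)

lemma disjoint_union_of_edges_iff: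
  "disjoint_union_of_edges k G \<longleftrightarrow>
     card sccs_verts = k \<and> (\<forall>X\<in>sccs_verts. card X = 2 \<and> clique_component G X)"
  unfolding disjoint_union_of_edges_def card_sccs_verts[symmetric]
  by (auto simp: sccs_conv_sccs_verts complete_component_iff)

lemma disjoint_union_of_edges_with_triangle_iff:
  "disjoint_union_of_edges_with_triangle k G \<longleftrightarrow>
     (\<exists>T\<in>sccs_verts. card T = 3 \<and> clique_component G T \<and> card (sccs_verts - {T}) = k \<and>
        (\<forall>X\<in>sccs_verts - {T}. card X = 2 \<and> clique_component G X))"
proof -
  have "sccs - {with_proj G \<restriction> T} = (\<lambda>X. with_proj G \<restriction> X) ` (sccs_verts - {T})" for T
    unfolding sccs_conv_sccs_verts using inj_on_induce[of UNIV] by (auto simp: inj_on_def)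
  then show ?thesis
    unfolding disjoint_union_of_edges_with_triangle_def
    by (simp add: sccs_conv_sccs_verts complete_component_iff card_image[OF inj_on_induce] conj_assoc cong: conj_cong)
qed

lemma clique_component_pair:
  assumes "parcs G `` {v} = {w}" "parcs G `` {w} = {v}"
  shows "clique_component G {v, w}" "card {v, w} = 2"
proof -
  have "(v, w) \<in> parcs G" using assms(1) by blast
  then have "v \<noteq> w" using irrefl_parcs by (auto simp: irrefl_def)
  then show "clique_component G {v, w}" "card {v, w} = 2"
    using assms by (auto simp: clique_component_def)
qed

lemma sccs_verts_eqI: "X \<in> sccs_verts \<Longrightarrow> Y \<in> sccs_verts \<Longrightarrow> v \<in> X \<Longrightarrow> v \<in> Y \<Longrightarrow> X = Y"
  using sccs_verts_disjoint by blast

lemma disjoint_union_of_edges_iff_matched: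
  assumes V: "pverts G = UNIV"
  shows "disjoint_union_of_edges k G \<longleftrightarrow> matched (parcs G) UNIV \<and> card (pverts G) = 2 * k"
proof -
  have "(\<forall>X\<in>sccs_verts. card X = 2 \<and> clique_component G X) \<longleftrightarrow> matched (parcs G) UNIV" (is "?L \<longleftrightarrow> ?R")
  proof
    assume L: ?L
    show ?R unfolding matched_def
    proof
      fix v
      obtain X where X: "X \<in> sccs_verts" "v \<in> X" using sccs_verts_cover V by blast
      then have nb: "parcs G `` {v} = X - {v}" and "card X = 2" using L by (auto simp: clique_component_def)
      then have "card (X - {v}) = 1" using X(2) by simp
      then show "\<exists>w. parcs G `` {v} \<inter> UNIV = {w}" using nb by (auto simp: card_1_singleton_iff)
    qed
  next
    assume R: ?R
    show ?L
    proof
      fix X assume X: "X \<in> sccs_verts"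
      then obtain v where v: "v \<in> X" by (auto simp: in_sccs_verts_conv_reachable)
      obtain w where w: "parcs G `` {v} = {w}"
        using R unfolding matched_def by auto
      obtain x where x: "parcs G `` {w} = {x}"
        using R unfolding matched_def by auto
      have "(v, w) \<in> parcs G" using w by blast
      then have "v \<in> parcs G `` {w}" using symD[OF sym_parcs] by blast
      then have "parcs G `` {w} = {v}" using x by simp
      note c = clique_component_pair[OF w this]
      have "{v, w} \<in> sccs_verts" by (rule clique_component_in_sccs_verts[OF c(1)]) (simp add: V)
      then have "X = {v, w}" using sccs_verts_eqI[OF X _ v] by blast
      then show "card X = 2 \<and> clique_component G X" using c by simp
    qed
  qed
  moreover have "card (pverts G) = 2 * card sccs_verts" if ?L
    using card_pverts_eq_sum that by simp
  ultimately show ?thesis unfolding disjoint_union_of_edges_iff by auto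
qed

lemma disjoint_union_of_edges_with_triangle_iff_matched:
  assumes V: "pverts G = UNIV"
  shows "disjoint_union_of_edges_with_triangle k G \<longleftrightarrow>
    matched_with_triangle (parcs G) UNIV \<and> card (pverts G) = 2 * k + 3"
proof -
  let ?tri = "\<lambda>T. T \<in> sccs_verts \<and> card T = 3 \<and> clique_component G T \<and>
        (\<forall>X\<in>sccs_verts - {T}. card X = 2 \<and> clique_component G X)"
  have count: "card (pverts G) = 2 * card (sccs_verts - {T}) + 3" if "?tri T" for T
    using card_pverts_eq_sum sum.remove[OF finite_sccs_verts, of T card] that by simp
  have "(\<exists>T. ?tri T) \<longleftrightarrow> matched_with_triangle (parcs G) UNIV"
  proof
    assume "\<exists>T. ?tri T"
    then obtain T where T: "?tri T" by blast
    then have nbT: "parcs G `` {v} = T - {v}" if "v \<in> T" for v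
      using that by (simp add: clique_component_def)
    have "matched (parcs G) (UNIV - T)" unfolding matched_def
    proof
      fix v assume v: "v \<in> UNIV - T"
      obtain X where X: "X \<in> sccs_verts" "v \<in> X" using sccs_verts_cover V by blast
      then have "X \<noteq> T" using v by blast
      then have "X \<inter> T = {}" using X(1) T sccs_verts_disjoint by blast
      moreover have nb: "parcs G `` {v} = X - {v}" "card X = 2"
        using T X \<open>X \<noteq> T\<close> by (auto simp: clique_component_def)
      moreover have "card (X - {v}) = 1" using nb(2) X(2) by simp
      ultimately show "\<exists>w. parcs G `` {v} \<inter> (UNIV - T) = {w}"
        by (auto simp: card_1_singleton_iff)
    qed
    then show "matched_with_triangle (parcs G) UNIV"
      using T nbT unfolding matched_with_triangle_def by auto
  next
    assume "matched_with_triangle (parcs G) UNIV"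
    then obtain T where T: "card T = 3" "\<And>v. v \<in> T \<Longrightarrow> parcs G `` {v} = T - {v}"
      "matched (parcs G) (UNIV - T)"
      unfolding matched_with_triangle_def by auto
    have cT: "clique_component G T" unfolding clique_component_def using T(1,2) by fastforce
    then have T_scc: "T \<in> sccs_verts" by (rule clique_component_in_sccs_verts) (simp add: V)
    have partner: "\<exists>w. parcs G `` {v} = {w} \<and> w \<notin> T" if v: "v \<notin> T" for v
    proof -
      have "u \<notin> T" if "(v, u) \<in> parcs G" for u
        using T(2)[of u] symD[OF sym_parcs that] v by blast
      then have "parcs G `` {v} \<inter> (UNIV - T) = parcs G `` {v}" by blast
      moreover obtain w where w: "parcs G `` {v} \<inter> (UNIV - T) = {w}"
        using T(3) v unfolding matched_def by auto
      moreover have "w \<in> parcs G `` {v} \<inter> (UNIV - T)" unfolding w by simp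
      ultimately show ?thesis by auto
    qed
    have "card X = 2 \<and> clique_component G X" if X: "X \<in> sccs_verts" "X \<noteq> T" for X
    proof -
      obtain v where v: "v \<in> X" using X(1) by (auto simp: in_sccs_verts_conv_reachable)
      then have "v \<notin> T" using sccs_verts_eqI[OF X(1) T_scc v] X(2) by blast
      then obtain w where w: "parcs G `` {v} = {w}" "w \<notin> T" using partner by blast
      obtain x where x: "parcs G `` {w} = {x}" using partner[OF w(2)] by blast
      have "(v, w) \<in> parcs G" using w by blast
      then have "v \<in> parcs G `` {w}" using symD[OF sym_parcs] by blast
      then have "parcs G `` {w} = {v}" using x by simp
      note c = clique_component_pair[OF w(1) this]
      have "{v, w} \<in> sccs_verts" by (rule clique_component_in_sccs_verts[OF c(1)]) (simp add: V)
      then have "X = {v, w}" using sccs_verts_eqI[OF X(1) _ v] by blast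
      then show "card X = 2 \<and> clique_component G X" using c by simp
    qed
    then show "\<exists>T. ?tri T" using T(1) cT T_scc by blast
  qed
  then show ?thesis unfolding disjoint_union_of_edges_with_triangle_iff using count by auto
qed

text \<open>
  The suspension of the subgraph induced on \<open>X\<close>, taken as a subgraph of the suspension of \<open>G\<close>. Cones
  over different components share nothing but the apex, so they form a \<open>1\<close>-sum.
\<close>
definition component_cone :: "'a set \<Rightarrow> ('a option, 'a option \<times> 'a option) pre_digraph" where
  "component_cone X = with_proj (suspension G) \<restriction> insert None (Some ` X)"

lemma complete_component_cone:
  assumes "clique_component G X" "X \<subseteq> pverts G"
  shows "complete_digraph (card X + 1) (component_cone X)"
proof -
  have fin: "finite X" using assms(2) pair_finite_verts finite_subset by blast
  have eq: "component_cone X = with_proj \<lparr>pverts = insert None (Some ` X),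
     parcs = {e \<in> parcs (suspension G). fst e \<in> insert None (Some ` X) \<and> snd e \<in> insert None (Some ` X)}\<rparr>"
    by (simp add: component_cone_def induce_subgraph_def with_proj_def)
  have "(u, v) \<in> parcs G \<longleftrightarrow> v \<in> X - {u}" if "u \<in> X" for u v
    using that assms(1) unfolding clique_component_def by blast
  then have "{e \<in> parcs (suspension G). fst e \<in> insert None (Some ` X) \<and> snd e \<in> insert None (Some ` X)}
      = {(i, j). (i, j) \<in> insert None (Some ` X) \<times> insert None (Some ` X) \<and> i \<noteq> j}"
    using assms(2) unfolding suspension_def by auto
  moreover have "card (insert None (Some ` X)) = card X + 1"
    using fin by (simp add: card_image)
  ultimately show ?thesis unfolding eq complete_digraph_pair_def using fin by simp
qed

lemma component_cone_all: "component_cone (pverts G) = with_proj (suspension G)"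
proof -
  have "pverts (suspension G) = insert None (Some ` pverts G)" by (simp add: suspension_def)
  moreover have "{e \<in> parcs (suspension G). fst e \<in> insert None (Some ` pverts G) \<and> snd e \<in> insert None (Some ` pverts G)}
      = parcs (suspension G)"
    using in_arcsD1 in_arcsD2 by (auto simp: suspension_def)
  ultimately show ?thesis unfolding component_cone_def induce_subgraph_def
    by (simp add: with_proj_def)
qed

lemma one_sum_component_cones:
  assumes "Xs \<noteq> []" "distinct Xs" "set Xs \<subseteq> sccs_verts"
  shows "is_one_sum (map component_cone Xs) (component_cone (\<Union>(set Xs)))"
  using assms
proof (induction Xs rule: rev_nonempty_induct)
  case (single X)
  then show ?case using is_one_sum.single by simp
next
  case (snoc X Xs)
  let ?Y = "\<Union>(set Xs)"
  have X: "X \<in> sccs_verts" "X \<notin> set Xs" and Xs: "set Xs \<subseteq> sccs_verts" using snoc.prems by auto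
  have disj: "?Y \<inter> X = {}" using sccs_verts_disjoint X Xs by fast
  have cut: "(u, v) \<notin> parcs G \<and> (v, u) \<notin> parcs G" if "u \<in> ?Y" "v \<in> X" for u v
  proof -
    have "(v, u) \<notin> parcs G" using sccs_verts_closed[OF X(1) that(2), of u] that(1) disj by blast
    then show ?thesis using symD[OF sym_parcs] by blast
  qed
  have "component_cone (?Y \<union> X) = union (component_cone ?Y) (component_cone X)"
  proof (rule pre_digraph.equality)
    show "arcs (component_cone (?Y \<union> X)) = arcs (union (component_cone ?Y) (component_cone X))"
    proof (rule set_eqI)
      fix e :: "'a option \<times> 'a option"
      obtain i j where e: "e = (i, j)" by fastforce
      show "e \<in> arcs (component_cone (?Y \<union> X)) \<longleftrightarrow> e \<in> arcs (union (component_cone ?Y) (component_cone X))"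
        using cut unfolding e union_def component_cone_def
        by (cases i; cases j) (simp_all add: suspension_arcs inj_image_mem_iff, blast+)
    qed
  qed (auto simp: union_def component_cone_def induce_subgraph_def)
  moreover have "is_one_sum (map component_cone Xs @ [component_cone X]) (union (component_cone ?Y) (component_cone X))"
  proof (rule is_one_sum.step)
    show "is_one_sum (map component_cone Xs) (component_cone ?Y)"
      using snoc by simp
    show "compatible (component_cone ?Y) (component_cone X)"
      by (simp add: compatible_def component_cone_def)
    have "verts (component_cone ?Y) \<inter> verts (component_cone X) = {None}"
      using disj by (auto simp: component_cone_def)
    then show "card (verts (component_cone ?Y) \<inter> verts (component_cone X)) = 1" by simp
  qed
  ultimately show ?case by (simp add: Un_commute)
qed

lemma one_sum_of_triangles:
  assumes "disjoint_union_of_edges k G" "k \<noteq> 0"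
  shows "\<exists>Ts. length Ts = k \<and> (\<forall>T\<in>set Ts. complete_digraph 3 T) \<and> is_one_sum Ts (with_proj (suspension G))"
proof -
  have E: "card sccs_verts = k" "\<And>X. X \<in> sccs_verts \<Longrightarrow> card X = 2 \<and> clique_component G X"
    using assms(1) unfolding disjoint_union_of_edges_iff by auto
  obtain Xs where Xs: "set Xs = sccs_verts" "distinct Xs"
    using finite_distinct_list[OF finite_sccs_verts] by blast
  have len: "length Xs = k" using distinct_card[OF Xs(2)] Xs(1) E(1) by simp
  then have "Xs \<noteq> []" using assms(2) by auto
  then have "is_one_sum (map component_cone Xs) (component_cone (\<Union> sccs_verts))"
    using one_sum_component_cones[of Xs] Xs by simp
  moreover have "\<Union> sccs_verts = pverts G"
    using sccs_verts_cover sccs_verts_subsets by blast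
  moreover have "complete_digraph 3 (component_cone X)" if "X \<in> set Xs" for X
    using complete_component_cone[of X] E(2)[of X] sccs_verts_subsets[of X] that Xs(1) by simp
  ultimately show ?thesis using len component_cone_all
    by (intro exI[of _ "map component_cone Xs"]) auto
qed

lemma one_sum_of_K4_and_triangles:
  assumes "disjoint_union_of_edges_with_triangle k G"
  shows "\<exists>K Ts. complete_digraph 4 K \<and> length Ts = k \<and> (\<forall>T\<in>set Ts. complete_digraph 3 T) \<and>
    is_one_sum (K # Ts) (with_proj (suspension G))"
proof -
  obtain T where T: "T \<in> sccs_verts" "card T = 3" "clique_component G T" "card (sccs_verts - {T}) = k"
    and E: "\<And>X. X \<in> sccs_verts - {T} \<Longrightarrow> card X = 2 \<and> clique_component G X"
    using assms unfolding disjoint_union_of_edges_with_triangle_iff by auto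
  obtain Xs where Xs: "set Xs = sccs_verts - {T}" "distinct Xs"
    using finite_distinct_list[of "sccs_verts - {T}"] finite_sccs_verts by blast
  have len: "length Xs = k" using distinct_card[OF Xs(2)] Xs(1) T(4) by simp
  have all: "set (T # Xs) = sccs_verts" "distinct (T # Xs)" using Xs T(1) by auto
  have "is_one_sum (map component_cone (T # Xs)) (component_cone (\<Union> sccs_verts))"
    using one_sum_component_cones[OF list.distinct(2) all(2)] all(1) by (simp only: subset_refl)
  moreover have "\<Union> sccs_verts = pverts G"
    using sccs_verts_cover sccs_verts_subsets by blast
  moreover have "complete_digraph 3 (component_cone X)" if "X \<in> set Xs" for X
    using complete_component_cone[of X] E[of X] sccs_verts_subsets[of X] that Xs(1) by simp
  moreover have "complete_digraph 4 (component_cone T)"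
    using complete_component_cone[of T] T sccs_verts_subsets[of T] by simp
  ultimately show ?thesis using len component_cone_all
    by (intro exI[of _ "component_cone T"] exI[of _ "map component_cone Xs"]) auto
qed

end

section \<open>The number of facets of a suspension\<close>
theorem theorem1p3:
  fixes G :: "'v::finite pair_pre_digraph" and n :: nat
  assumes "n \<ge> 2"
    and "CARD('v) = n - 1"
    and "pair_graph G"
    and "pverts G = UNIV"
  shows
    "let N = num_facets (symmetric_edge_polytope (suspension G));
         U = (if odd n then 6 powr ((real n - 1) / 2) else 14 * 6 powr (real n / 2 - 2))
     in
       N \<ge> 2 ^ (n - 1) \<and>
       (N = 2 ^ (n - 1) \<longleftrightarrow> parcs G = {}) \<and>
       (parcs G = {} \<longrightarrow> complete_bipartite_digraph 1 (n - 1) (with_proj (suspension G))) \<and>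
       real N \<le> U \<and>
       (real N = U \<longleftrightarrow>
          (odd n \<and> disjoint_union_of_edges ((n - 1) div 2) G) \<or>
          (even n \<and> (\<exists>k. n div 2 = k + 2 \<and> disjoint_union_of_edges_with_triangle k G))) \<and>
       (odd n \<and> disjoint_union_of_edges ((n - 1) div 2) G \<longrightarrow>
          (\<exists>Ts. length Ts = (n - 1) div 2 \<and> (\<forall>T \<in> set Ts. complete_digraph 3 T) \<and>
                is_one_sum Ts (with_proj (suspension G)))) \<and>
       (\<forall>k. even n \<and> n div 2 = k + 2 \<and> disjoint_union_of_edges_with_triangle k G \<longrightarrow>
          (\<exists>K Ts. complete_digraph 4 K \<and> length Ts = k \<and> (\<forall>T \<in> set Ts. complete_digraph 3 T) \<and>
                  is_one_sum (K # Ts) (with_proj (suspension G))))"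
proof -
  interpret pair_graph G by fact
  note E = sym_parcs irrefl_parcs
  define N where "N = num_facets (symmetric_edge_polytope (suspension G))"
  define U where "U = (if odd n then 6 powr ((real n - 1) / 2) else 14 * 6 powr (real n / 2 - 2))"
  have N: "N = num_patterns (parcs G) UNIV"
    unfolding N_def by (rule num_facets_suspension[OF sym_parcs assms(4)])
  have card: "card (UNIV :: 'v set) = n - 1" "card (pverts G) = n - 1" using assms(2,4) by simp_all
  have lower: "2 ^ (n - 1) \<le> N" "N = 2 ^ (n - 1) \<longleftrightarrow> parcs G = {}"
    using num_patterns_lower[OF finite E, of UNIV] unfolding N card by auto
  have star: "complete_bipartite_digraph 1 (n - 1) (with_proj (suspension G))" if "parcs G = {}"
    unfolding complete_bipartite_digraph_pair_def
  proof (intro conjI exI)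
    show "card (Some ` (UNIV :: 'v set)) = n - 1" using card(1) by (simp add: card_image)
    show "parcs (suspension G) = {None} \<times> (Some ` UNIV) \<union> (Some ` UNIV) \<times> {None}"
      using that assms(4) by (auto simp: suspension_def)
  qed (use assms(4) in \<open>auto simp: suspension_def\<close>)
  have upper: "real N \<le> U \<and> (real N = U \<longleftrightarrow>
          (odd n \<and> disjoint_union_of_edges ((n - 1) div 2) G) \<or>
          (even n \<and> (\<exists>k. n div 2 = k + 2 \<and> disjoint_union_of_edges_with_triangle k G)))"
  proof (cases "odd n")
    case True
    then obtain k where k: "n = 2 * k + 1" by (rule oddE)
    have "U = 6 powr real k" using True unfolding U_def by (simp add: k)
    then have U: "U = sqrt 6 ^ (n - 1)" by (simp add: k powr_realpow sqrt6_power_even)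
    have "disjoint_union_of_edges ((n - 1) div 2) G \<longleftrightarrow> matched (parcs G) UNIV"
      unfolding disjoint_union_of_edges_iff_matched[OF assms(4)] using card(2) k by simp
    then show ?thesis
      using True num_patterns_le_sqrt6_power[OF E finite, of UNIV]
        num_patterns_eq_sqrt6_power_iff[OF E finite, of UNIV]
      unfolding N U card by simp
  next
    case False
    then obtain k where k: "n = 2 * (k + 1)"
      using assms(1) by (metis evenE Suc_eq_plus1 not0_implies_Suc mult_0_right not_numeral_le_zero)
    \<comment> \<open>For \<open>n = 2\<close> the exponent is \<open>- 1\<close>, so one factor \<open>6\<close> is split off to reach a natural power.\<close>
    have "real n / 2 - 2 = real k - 1" by (simp add: k)
    moreover have "U = 14 * 6 powr (real n / 2 - 2)" unfolding U_def using False by (rule if_not_P)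
    ultimately have "U = 14 * 6 powr (real k - 1)" by (simp only:)
    then have "U = 14 * (6 powr real k / 6)" by (simp add: powr_diff)
    then have U: "U = 7 / 3 * sqrt 6 ^ (n - 1 - 1)" by (simp add: k powr_realpow sqrt6_power_even)
    have odd: "odd (card (UNIV :: 'v set))" using card(1) k by simp
    have "(\<exists>j. n div 2 = j + 2 \<and> disjoint_union_of_edges_with_triangle j G)
        \<longleftrightarrow> matched_with_triangle (parcs G) UNIV"
    proof
      assume m: "matched_with_triangle (parcs G) UNIV"
      then obtain T :: "'v set" where "card T = 3"
        unfolding matched_with_triangle_def by blast
      then have "3 \<le> n - 1" using card_mono[OF finite, of T UNIV] card(1) by simp
      then obtain j where "k = Suc j" using k by (cases k) auto
      then have "n div 2 = j + 2" "card (pverts G) = 2 * j + 3" using card(2) k by simp_all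
      then show "\<exists>j. n div 2 = j + 2 \<and> disjoint_union_of_edges_with_triangle j G"
        using m disjoint_union_of_edges_with_triangle_iff_matched[OF assms(4)] by blast
    qed (use disjoint_union_of_edges_with_triangle_iff_matched[OF assms(4)] in blast)
    then show ?thesis
      using False num_patterns_odd_le(1)[OF E finite odd] num_patterns_odd_eq_iff[OF E finite odd]
      unfolding N U card by simp
  qed
  have "(n - 1) div 2 \<noteq> 0" if "odd n" using that assms(1) by presburger
  then show ?thesis
    unfolding N_def[symmetric] U_def[symmetric] Let_def
    using lower star upper one_sum_of_triangles one_sum_of_K4_and_triangles by blast
qed

end
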